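(* Consider a Markov decision process with finite state space $\mathcal{S}$ and finite action space $\mathcal{A}$. Let $\Pi$ be the set of all deterministic policies $\mathcal{S}\to\mathcal{A}$, so $|\Pi|=|\mathcal{A}|^{|\mathcal{S}|}$. Let $\pi_b$ be a behavior policy and let $\mathcal{D}=\{(s^i,a^i)\}_{i=1}^{|\mathcal{D}|}$ be a dataset of state-action pairs drawn i.i.d. from the state-action occupancy distribution $\rho_{\pi_b}(s,a)$. Assume that there does not exist a policy $\pi\in\Pi$ such that $\pi(s^i)=a^i$ for all $i\in\{1,\dots,|\mathcal{D}|\}$. Let $\hat{\pi}_b$ be the empirical behavior policy and $\rho_{\hat{\pi}_b}$ its state marginal occupancy (the empirical distribution of the states in $\mathcal{D}$). Suppose behavior cloning begins from an initial policy $\pi_0$ (with state occupancy $\rho_{\pi_0}$) and returns the policy $\pi\in\Pi$. Then for any $\delta>0$ (with $\delta<1$), with probability at least $1-\delta$, \[ D_{\mathrm{TV}}(\rho_{\pi}(s,a)\,\|\,\rho_{\pi_b}(s,a)) \le c(\pi_0,\pi_b,|\mathcal{D}|), \] where \[ \begin{aligned} c(\pi_0,\pi_b,|\mathcal{D}|) ={}& \tfrac{1}{2}\sum_{s\notin\mathcal{D}}\rho_{\pi_b}(s) + \tfrac{1}{2}\sum_{s\notin\mathcal{D}}|\rho_\pi(s)-\rho_{\pi_0}(s)| + \tfrac{1}{2}\sum_{s\notin\mathcal{D}}|\rho_{\pi_0}(s)-\rho_{\pi_b}(s)| \\ &+ \tfrac{1}{2}\sum_{s\in\mathcal{D}}|\rho_\pi(s)-\rho_{\hat{\pi}_b}(s)|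 + \frac{1}{|\mathcal{D}|}\sum_{i=1}^{|\mathcal{D}|}\mathbb{I}\left[\pi(s^i)\neq a^i\right] \\ &+ \left[\frac{\log|\mathcal{S}|+\log(2/\delta)}{2|\mathcal{D}|}\right]^{1/2} + \left[\frac{\log|\Pi|+\log(2/\delta)}{2|\mathcal{D}|}\right]^{1/2}. \end{aligned} \]
   Context: For a policy $\pi$, the occupancy measure is $\rho_\pi(s,a)=\sum_{t\ge0}\gamma^t P(s_t=s,a_t=a\mid\pi)=\pi(a|s)\rho_\pi(s)$ with state occupancy $\rho_\pi(s)=\sum_{t\ge 0}\gamma^tP(s_t=s\mid\pi)$, where $\gamma\in[0,1]$ is the discount factor; these are treated as distributions. The empirical behavior policy is $\hat{\pi}_b(a|s)=\frac{\sum_{(s',a')\in\mathcal{D}}\mathbb{I}[s'=s,a'=a]}{\sum_{s'\in\mathcal{D}}\mathbb{I}[s'=s]}$. "$s\in\mathcal{D}$" means $s$ equals one of the states $s^i$ in the dataset, and "$s\notin\mathcal{D}$" means it does not. For a deterministic policy $\pi$, $\pi(s)$ denotes the action it selects at $s$. $\mathbb{I}$ is the indicator function, and $D_{\mathrm{TV}}(p\|q)=\frac12\sum_x|p(x)-q(x)|$.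
   Formalization: Occupancy measures carry the normalizing factor (1−γ) and γ<1 is required, since the unnormalized sum is not a distribution (and diverges at γ=1); the assumption that no policy fits the data is read as part of the event: with probability ≥ 1−δ, if no policy fits, the bound holds for every π in Π. *)

theory Defs
  imports "HOL-Probability.Probability"
begin

text \<open>Finite MDP: states of finite type 's, actions of finite type 'a,
  initial state distribution mu0, transition kernel P.
  A (stochastic) policy is a map 's => 'a pmf; a deterministic policy f :: 's => 'a
  is embedded as det_pol f.\<close>

definition det_pol :: "('s \<Rightarrow> 'a) \<Rightarrow> ('s \<Rightarrow> 'a pmf)" where
  "det_pol f = (\<lambda>s. return_pmf (f s))"

fun state_dist :: "'s::finite pmf \<Rightarrow> ('s \<Rightarrow> 'a::finite \<Rightarrow> 's pmf) \<Rightarrow> ('s \<Rightarrow> 'a pmf)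
                    \<Rightarrow> nat \<Rightarrow> 's \<Rightarrow> real" where
  "state_dist mu0 P pol 0 s = pmf mu0 s"
| "state_dist mu0 P pol (Suc t) s =
     (\<Sum>s'\<in>UNIV. \<Sum>a\<in>UNIV. state_dist mu0 P pol t s' * pmf (pol s') a * pmf (P s' a) s)"

text \<open>Normalized discounted state occupancy (a probability distribution for 0 <= gamma < 1).\<close>
definition occ_state :: "real \<Rightarrow> 's::finite pmf \<Rightarrow> ('s \<Rightarrow> 'a::finite \<Rightarrow> 's pmf)
                          \<Rightarrow> ('s \<Rightarrow> 'a pmf) \<Rightarrow> 's \<Rightarrow> real" where
  "occ_state \<gamma> mu0 P pol s = (1 - \<gamma>) * (\<Sum>t. \<gamma> ^ t * state_dist mu0 P pol t s)"

definition occ_sa :: "real \<Rightarrow> 's::finite pmf \<Rightarrow> ('s \<Rightarrow> 'a::finite \<Rightarrow> 's pmf)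
                       \<Rightarrow> ('s \<Rightarrow> 'a pmf) \<Rightarrow> 's \<Rightarrow> 'a \<Rightarrow> real" where
  "occ_sa \<gamma> mu0 P pol s a = pmf (pol s) a * occ_state \<gamma> mu0 P pol s"

definition data_prob :: "nat \<Rightarrow> ('x::finite \<Rightarrow> real) \<Rightarrow> ('x list \<Rightarrow> bool) \<Rightarrow> real" where
  "data_prob N q E =
     (\<Sum>D\<in>{D. length D = N}. (\<Prod>i<N. q (D ! i)) * (if E D then 1 else 0))"

definition data_states :: "('s \<times> 'a) list \<Rightarrow> 's set" where
  "data_states D = fst ` set D"

text \<open>State marginal of the empirical behaviour policy: empirical distribution of the states in D.\<close>
definition emp_state :: "('s \<times> 'a) list \<Rightarrow> 's \<Rightarrow> real" where
  "emp_state D s = real (length (filter (\<lambda>x. fst x = s) D)) / real (length D)"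

definition tv :: "('x::finite \<Rightarrow> real) \<Rightarrow> ('x \<Rightarrow> real) \<Rightarrow> real" where
  "tv p q = (1/2) * (\<Sum>x\<in>UNIV. \<bar>p x - q x\<bar>)"

end

theory Submission
  imports Defs
begin

text \<open>
  Fix a policy \<open>\<pi>\<close> and write \<open>q\<close> for the state-action occupancy of the behaviour policy, \<open>m\<close> for the
  empirical frequencies. Bounding \<open>1/2 * \<Sum>s\<in>D. \<bar>\<rho>\<^sub>b s - m s\<bar>\<close> separately would cost
  \<open>sqrt (|S| / N)\<close>, which the term with \<open>log |S|\<close> does not cover. Instead all errors at a state are
  combined: after cancelling terms of equal total mass, the right-hand side without the two square
  roots falls short of the total variation distance by at most \<open>\<Sum>s. max\<^sub>a (m(s,a) - q(s,a))\<^sup>+\<close>.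
  One sample changes this sum by at most \<open>1/N\<close>, so McDiarmid's inequality gives concentration
  around its mean within \<open>sqrt (ln (1/\<delta>) / (2 N))\<close>, which the first square root covers.

  It remains to bound the mean by \<open>sqrt (|S| ln |A| / (2 N))\<close>. By the Cauchy-Schwarz inequality it suffices that each
  state contributes at most \<open>sqrt (\<rho>\<^sub>b(s) ln |A| / (2 N))\<close>. For at least three actions this follows
  from a second moment bound. For two actions the second moment is too weak; here the summands are bounded by
  mean deviations of binomial distributions, computed exactly by de Moivre's formula and compared
  with the Poisson distribution, and unseen states yield a small negative correction. With one action
  or one sample some policy fits the data.
\<close>

section \<open>Expectations over i.i.d. samples\<close>

text \<open>The recursion integrates out the first sample, so facts about the product distribution
  become inductions on the sample size in which \<open>F\<close> varies.\<close>

fun iid_exp :: "('x::finite \<Rightarrow> real) \<Rightarrow> nat \<Rightarrow> ('x list \<Rightarrow> real) \<Rightarrow> real" where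
  "iid_exp q 0 F = F []"
| "iid_exp q (Suc N) F = (\<Sum>x\<in>UNIV. q x * iid_exp q N (\<lambda>D. F (x # D)))"

lemma sum_lists_eq_iid_exp:
  "(\<Sum>D\<in>{D. length D = N}. (\<Prod>i<N. q (D ! i)) * F D) = iid_exp q N F"
proof (induction N arbitrary: F)
  case 0
  then show ?case by simp
next
  case (Suc N)
  have img: "{D::'a list. length D = Suc N} = (\<lambda>(x, D). x # D) ` (UNIV \<times> {D. length D = N})"
    by (auto simp: length_Suc_conv image_iff)
  have inj: "inj_on (\<lambda>(x, D). x # D) (UNIV \<times> {D::'a list. length D = N})"
    by (auto simp: inj_on_def)
  have "(\<Sum>D\<in>{D. length D = Suc N}. (\<Prod>i<Suc N. q (D ! i)) * F D) =
        (\<Sum>(x, D)\<in>UNIV \<times> {D. length D = N}. (\<Prod>i<Suc N. q ((x # D) ! i)) * F (x # D))"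
    unfolding img by (subst sum.reindex[OF inj]) (simp add: case_prod_unfold)
  also have "\<dots> = (\<Sum>x\<in>UNIV. \<Sum>D\<in>{D. length D = N}. q x * ((\<Prod>i<N. q (D ! i)) * F (x # D)))"
    by (subst sum.cartesian_product[symmetric])
       (simp add: prod.lessThan_Suc_shift mult.assoc del: prod.lessThan_Suc)
  also have "\<dots> = iid_exp q (Suc N) F"
    using Suc.IH[of "\<lambda>D. F (_ # D)"] by (simp add: sum_distrib_left[symmetric])
  finally show ?case .
qed

lemma data_prob_eq_iid_exp:
  "data_prob N q E = iid_exp q N (\<lambda>D. if E D then 1 else 0)"
  unfolding data_prob_def by (rule sum_lists_eq_iid_exp)

lemma iid_exp_cong:
  "(\<And>D. length D = N \<Longrightarrow> F D = G D) \<Longrightarrow> iid_exp q N F = iid_exp q N G"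
proof (induction N arbitrary: F G)
  case (Suc N)
  have "iid_exp q N (\<lambda>D. F (x # D)) = iid_exp q N (\<lambda>D. G (x # D))" for x
    by (rule Suc.IH) (simp add: Suc.prems)
  then show ?case by simp
qed simp

lemma iid_exp_add: "iid_exp q N (\<lambda>D. F D + G D) = iid_exp q N F + iid_exp q N G"
  by (induction N arbitrary: F G) (simp_all add: distrib_left sum.distrib)

lemma iid_exp_cmult: "iid_exp q N (\<lambda>D. c * F D) = c * iid_exp q N F"
  by (induction N arbitrary: F) (simp_all add: sum_distrib_left mult.left_commute)

lemma iid_exp_diff: "iid_exp q N (\<lambda>D. F D - G D) = iid_exp q N F - iid_exp q N G"
  using iid_exp_add[of q N F "\<lambda>D. (-1) * G D"] by (simp only: iid_exp_cmult) simp

lemma iid_exp_sum: "iid_exp q N (\<lambda>D. \<Sum>i\<in>I. F i D) = (\<Sum>i\<in>I. iid_exp q N (F i))"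
proof (induction N arbitrary: F)
  case (Suc N)
  then show ?case by (simp add: sum_distrib_left) (rule sum.swap)
qed simp

locale finite_prob =
  fixes q :: "'x::finite \<Rightarrow> real"
  assumes nonneg: "0 \<le> q x" and total: "(\<Sum>x\<in>UNIV. q x) = 1"
begin

lemma iid_exp_const: "iid_exp q N (\<lambda>_. c) = c"
  by (induction N) (simp_all add: sum_distrib_right[symmetric] total)

lemma iid_exp_mono:
  "(\<And>D. length D = N \<Longrightarrow> F D \<le> G D) \<Longrightarrow> iid_exp q N F \<le> iid_exp q N G"
proof (induction N arbitrary: F G)
  case (Suc N)
  then show ?case by (auto intro!: sum_mono mult_left_mono nonneg)
qed simp

text \<open>Nonnegativity of the variance of \<open>F\<close>.\<close>

lemma iid_exp_square_ge: "(iid_exp q N F)\<^sup>2 \<le> iid_exp q N (\<lambda>D. (F D)\<^sup>2)"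
proof -
  let ?m = "iid_exp q N F"
  have "0 \<le> iid_exp q N (\<lambda>D. (F D - ?m)\<^sup>2)"
    using iid_exp_mono[of N "\<lambda>_. 0" "\<lambda>D. (F D - ?m)\<^sup>2"] by (simp add: iid_exp_const)
  also have "(\<lambda>D. (F D - ?m)\<^sup>2) = (\<lambda>D. (F D)\<^sup>2 - (2 * ?m * F D - ?m\<^sup>2))"
    by (auto simp: power2_eq_square algebra_simps)
  also have "iid_exp q N \<dots> = iid_exp q N (\<lambda>D. (F D)\<^sup>2) - (2 * ?m * ?m - ?m\<^sup>2)"
    by (simp only: iid_exp_diff iid_exp_cmult iid_exp_const)
  finally show ?thesis by (simp add: power2_eq_square)
qed

lemma iid_exp_sum_list:
  assumes "(\<Sum>x\<in>UNIV. q x * g x) = 0"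
  shows "iid_exp q N (\<lambda>D. \<Sum>x\<leftarrow>D. g x) = 0"
  by (induction N)
     (simp_all add: iid_exp_add iid_exp_const distrib_left sum.distrib assms)

text \<open>Since \<open>g\<close> is centred, the cross term between the first sample and the
  others has mean zero, so variances add.\<close>

lemma iid_exp_sum_list_square:
  assumes "(\<Sum>x\<in>UNIV. q x * g x) = 0"
  shows "iid_exp q N (\<lambda>D. (\<Sum>x\<leftarrow>D. g x)\<^sup>2) = real N * (\<Sum>x\<in>UNIV. q x * (g x)\<^sup>2)"
proof (induction N)
  case (Suc N)
  have "iid_exp q N (\<lambda>D. (g x + (\<Sum>x\<leftarrow>D. g x))\<^sup>2) = (g x)\<^sup>2 + real N * (\<Sum>x\<in>UNIV. q x * (g x)\<^sup>2)" for x
  proof -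
    have "(\<lambda>D. (g x + (\<Sum>x\<leftarrow>D. g x))\<^sup>2) =
        (\<lambda>D. (g x)\<^sup>2 + (2 * g x * (\<Sum>x\<leftarrow>D. g x) + (\<Sum>x\<leftarrow>D. g x)\<^sup>2))"
      by (auto simp: power2_eq_square algebra_simps)
    then show ?thesis
      by (simp only: iid_exp_add iid_exp_cmult iid_exp_const iid_exp_sum_list[OF assms] Suc.IH)
  qed
  then show ?case
    by (simp add: distrib_left sum.distrib sum_distrib_right[symmetric] total distrib_right)
qed simp

section \<open>Concentration of functions with bounded differences\<close>

lemma Hoeffding_lemma:
  fixes g :: "'x \<Rightarrow> real"
  assumes "\<theta> > 0" and g: "\<And>x y. g x \<le> g y + c"
  shows "(\<Sum>x\<in>UNIV. q x * exp (\<theta> * g x)) \<le> exp (\<theta> * (\<Sum>x\<in>UNIV. q x * g x) + \<theta>\<^sup>2 * c\<^sup>2 / 8)"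
proof -
  define p where "p = embed_pmf q"
  have "(\<integral>\<^sup>+x. ennreal (q x) \<partial>count_space UNIV) = 1"
    by (simp add: nn_integral_count_space_finite nonneg total sum_nonneg)
  then have p: "pmf p x = q x" for x
    unfolding p_def by (intro pmf_embed_pmf) (auto simp: nonneg)
  define a where "a = Min (range g)"
  have a: "a \<le> g x" for x by (simp add: a_def)
  obtain y where y: "a = g y"
    using Min_in[of "range g"] by (auto simp: a_def simp del: Min_in)
  interpret interval_bounded_random_variable p g a "a + c"
    using a g unfolding y by unfold_locales (auto simp: AE_measure_pmf_iff)
  have E: "measure_pmf.expectation p f = (\<Sum>x\<in>UNIV. q x * f x)" for f :: "'x \<Rightarrow> real"
    using integral_measure_pmf_real[of UNIV p f] by (simp add: p mult.commute)
  have "ennreal (measure_pmf.expectation p (\<lambda>x. exp (\<theta> * (g x - measure_pmf.expectation p g)))) =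
        (\<integral>\<^sup>+x. ennreal (exp (\<theta> * (g x - measure_pmf.expectation p g))) \<partial>p)"
    by (intro nn_integral_eq_integral[symmetric] integrable_measure_pmf_finite) auto
  also have "\<dots> \<le> ennreal (exp (\<theta>\<^sup>2 * c\<^sup>2 / 8))"
    using Hoeffdings_lemma_nn_integral[OF \<open>\<theta> > 0\<close>] by simp
  finally have *: "measure_pmf.expectation p (\<lambda>x. exp (\<theta> * (g x - measure_pmf.expectation p g))) \<le> exp (\<theta>\<^sup>2 * c\<^sup>2 / 8)"
    by (subst (asm) ennreal_le_iff) auto
  have "(\<Sum>x\<in>UNIV. q x * exp (\<theta> * g x)) =
      exp (\<theta> * measure_pmf.expectation p g) *
      measure_pmf.expectation p (\<lambda>x. exp (\<theta> * (g x - measure_pmf.expectation p g)))"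
    unfolding E by (simp add: sum_distrib_left right_diff_distrib exp_diff)
  also have "\<dots> \<le> exp (\<theta> * measure_pmf.expectation p g) * exp (\<theta>\<^sup>2 * c\<^sup>2 / 8)"
    by (intro mult_left_mono *) simp
  also have "\<dots> = exp (\<theta> * (\<Sum>x\<in>UNIV. q x * g x) + \<theta>\<^sup>2 * c\<^sup>2 / 8)"
    unfolding E by (simp add: exp_add)
  finally show ?thesis .
qed

text \<open>A martingale argument in recursive form. Averaging \<open>F\<close> over all samples but
  the first leaves a function \<open>g\<close> that still oscillates by at most \<open>c\<close>;
  Hoeffding's lemma treats \<open>g\<close>, and the induction hypothesis treats the remaining
  samples once the first is fixed.\<close>

lemma bounded_difference_mgf:
  assumes "\<theta> > 0"
    and "\<And>xs ys x y. F (xs @ x # ys) \<le> F (xs @ y # ys) + c"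
  shows "iid_exp q N (\<lambda>D. exp (\<theta> * F D)) \<le> exp (\<theta> * iid_exp q N F + real N * (\<theta>\<^sup>2 * c\<^sup>2 / 8))"
  using assms(2)
proof (induction N arbitrary: F)
  case (Suc N)
  define g where "g x = iid_exp q N (\<lambda>D. F (x # D))" for x
  have g: "g x \<le> g y + c" for x y
  proof -
    have "g x \<le> iid_exp q N (\<lambda>D. F (y # D) + c)"
      unfolding g_def using Suc.prems[of "[]"] by (intro iid_exp_mono) simp
    then show ?thesis by (simp add: g_def iid_exp_add iid_exp_const)
  qed
  have "iid_exp q (Suc N) (\<lambda>D. exp (\<theta> * F D)) \<le>
        (\<Sum>x\<in>UNIV. q x * exp (\<theta> * g x + real N * (\<theta>\<^sup>2 * c\<^sup>2 / 8)))"
    unfolding g_def iid_exp.simps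
  proof (intro sum_mono mult_left_mono nonneg Suc.IH)
    show "F (x # xs @ a # ys) \<le> F (x # xs @ b # ys) + c" for x xs ys a b
      using Suc.prems[of "x # xs"] by simp
  qed
  also have "\<dots> = exp (real N * (\<theta>\<^sup>2 * c\<^sup>2 / 8)) * (\<Sum>x\<in>UNIV. q x * exp (\<theta> * g x))"
    by (simp add: exp_add sum_distrib_left sum_distrib_right mult_ac)
  also have "\<dots> \<le> exp (real N * (\<theta>\<^sup>2 * c\<^sup>2 / 8)) * exp (\<theta> * (\<Sum>x\<in>UNIV. q x * g x) + \<theta>\<^sup>2 * c\<^sup>2 / 8)"
    by (intro mult_left_mono Hoeffding_lemma assms(1) g) simp
  also have "\<dots> = exp (\<theta> * iid_exp q (Suc N) F + real (Suc N) * (\<theta>\<^sup>2 * c\<^sup>2 / 8))"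
    by (simp add: g_def exp_add[symmetric] algebra_simps)
  finally show ?case .
qed simp

theorem McDiarmid_inequality:
  assumes "N > 0" and "t > 0"
    and diff: "\<And>xs ys x y. F (xs @ x # ys) \<le> F (xs @ y # ys) + 1"
  shows "iid_exp q N (\<lambda>D. if F D \<le> iid_exp q N F + t then 1 else 0)
    \<ge> 1 - exp (- 2 * t\<^sup>2 / real N)"
proof -
  \<comment> \<open>This value minimises the Chernoff exponent
    \<open>- (\<theta> * t) + real N * \<theta>\<^sup>2 / 8\<close>.\<close>
  define \<theta> where "\<theta> = 4 * t / real N"
  have \<theta>: "\<theta> > 0" using assms by (simp add: \<theta>_def)
  let ?m = "iid_exp q N F"
  have "iid_exp q N (\<lambda>D. 1 - (if F D \<le> ?m + t then 1 else 0)) \<le>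
        iid_exp q N (\<lambda>D. exp (- (\<theta> * (?m + t))) * exp (\<theta> * F D))"
  proof (intro iid_exp_mono)
    fix D :: "'x list"
    have "1 \<le> exp (\<theta> * (F D - (?m + t)))" if "\<not> F D \<le> ?m + t"
      using that \<theta> by simp
    then show "1 - (if F D \<le> ?m + t then 1 else 0) \<le> exp (- (\<theta> * (?m + t))) * exp (\<theta> * F D)"
      by (auto simp: exp_add[symmetric] algebra_simps)
  qed
  also have "\<dots> \<le> exp (- (\<theta> * (?m + t))) * exp (\<theta> * ?m + real N * (\<theta>\<^sup>2 * 1\<^sup>2 / 8))"
    unfolding iid_exp_cmult by (intro mult_left_mono bounded_difference_mgf \<theta> diff) simp
  also have "\<dots> = exp (- (\<theta> * t) + real N * \<theta>\<^sup>2 / 8)"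
    by (simp add: exp_add[symmetric] algebra_simps)
  also have "- (\<theta> * t) + real N * \<theta>\<^sup>2 / 8 = - 2 * t\<^sup>2 / real N"
    using assms(1) by (simp add: \<theta>_def power2_eq_square field_simps)
  finally show ?thesis by (simp add: iid_exp_diff iid_exp_const)
qed

end

section \<open>The excess of a data set\<close>

text \<open>
  In counting units (\<open>Q = N q\<close>), the contribution of the state \<open>s\<close> to the gap between the
  total variation distance and the empirical terms of the bound, maximised over the action the
  cloned policy takes at \<open>s\<close>. At an unseen state the correct contribution is \<open>- Q (s, \<pi> s)\<close>; taking
  \<open>- min 1 (Min \<dots>)\<close> keeps the effect of a single sample within \<open>[0, 1]\<close>. That this
  branch is negative is only exploited when there are two actions.
\<close>

definition excess :: "('s::finite \<times> 'a::finite \<Rightarrow> real) \<Rightarrow> ('s \<times> 'a) list \<Rightarrow> 's \<Rightarrow> real" where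
  "excess Q D s =
     (if s \<in> data_states D then Max (range (\<lambda>a. max 0 (real (count_list D (s, a)) - Q (s, a))))
      else - min 1 (Min (range (\<lambda>a. Q (s, a)))))"

lemma Max_range_leI: "(\<And>a. f a \<le> c) \<Longrightarrow> Max (range f) \<le> c"
  for f :: "'a::finite \<Rightarrow> real"
  by simp

lemma Max_range_geI: "c \<le> f a \<Longrightarrow> c \<le> Max (range f)"
  for f :: "'a::finite \<Rightarrow> real"
  by (rule order.trans[OF _ Max_ge]) auto

lemma count_list_eq_0_if_unseen: "s \<notin> data_states D \<Longrightarrow> count_list D (s, a) = 0"
  by (force simp: data_states_def count_list_0_iff)

lemma excess_insert:
  assumes "\<And>x. 0 \<le> Q x"
  shows "excess Q (xs @ ys) s \<le> excess Q (xs @ x # ys) s"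
    and "excess Q (xs @ x # ys) s \<le> excess Q (xs @ ys) s + (if fst x = s then 1 else 0)"
proof -
  let ?f = "\<lambda>D a. max 0 (real (count_list D (s, a)) - Q (s, a))"
  have "excess Q (xs @ ys) s \<le> excess Q (xs @ x # ys) s \<and>
    excess Q (xs @ x # ys) s \<le> excess Q (xs @ ys) s + (if fst x = s then 1 else 0)"
  proof (cases "fst x = s")
    case False
    then have "x \<noteq> (s, a)" for a by auto
    with False show ?thesis by (auto simp: excess_def data_states_def)
  next
    case True
    then have new: "excess Q (xs @ x # ys) s = Max (range (?f (xs @ x # ys)))"
      by (auto simp: excess_def data_states_def)
    show ?thesis
    proof (cases "s \<in> data_states (xs @ ys)")
      case seen: True
      have "?f (xs @ ys) a \<le> ?f (xs @ x # ys) a" for a by (simp add: max_def)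
      then have "Max (range (?f (xs @ ys))) \<le> Max (range (?f (xs @ x # ys)))"
        by (intro Max_range_leI) (rule Max_range_geI)
      moreover have "?f (xs @ x # ys) a \<le> ?f (xs @ ys) a + 1" for a by (simp add: max_def)
      then have "Max (range (?f (xs @ x # ys))) \<le> Max (range (?f (xs @ ys))) + 1"
        by (intro Max_range_leI) (smt (verit) Max_range_geI)
      ultimately show ?thesis using seen True new by (simp add: excess_def)
    next
      case unseen: False
      have cnt: "count_list (xs @ ys) (s, a) = 0" for a
        by (rule count_list_eq_0_if_unseen[OF unseen])
      \<comment> \<open>The first visit lifts the value from \<open>- m\<close> to at most
        \<open>1 - m\<close>, where \<open>m\<close> is the minimum in the unseen branch:
        \<open>m\<close> is at most 1 and at most \<open>Q (s, a)\<close>, while the count is at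
        most 1. Without the cap at 1 the jump could exceed 1.\<close>
      have "?f (xs @ x # ys) a \<le> 1 - min 1 (Min (range (\<lambda>a. Q (s, a))))" for a
      proof -
        have "Min (range (\<lambda>a. Q (s, a))) \<le> Q (s, a)" by simp
        moreover have "real (count_list (xs @ x # ys) (s, a)) \<le> 1"
          using cnt[of a] by simp
        ultimately show ?thesis by linarith
      qed
      then have "Max (range (?f (xs @ x # ys))) \<le> 1 - min 1 (Min (range (\<lambda>a. Q (s, a))))"
        by (rule Max_range_leI)
      moreover have "0 \<le> Max (range (?f (xs @ x # ys)))"
        by (rule Max_range_geI) simp
      moreover have "0 \<le> min 1 (Min (range (\<lambda>a. Q (s, a))))" using assms by simp
      moreover have "excess Q (xs @ ys) s = - min 1 (Min (range (\<lambda>a. Q (s, a))))"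
        using unseen by (simp add: excess_def)
      ultimately have "excess Q (xs @ ys) s \<le> excess Q (xs @ x # ys) s"
        and "excess Q (xs @ x # ys) s \<le> excess Q (xs @ ys) s + 1"
        unfolding new by argo+
      then show ?thesis using True by simp
    qed
  qed
  then show "excess Q (xs @ ys) s \<le> excess Q (xs @ x # ys) s"
    and "excess Q (xs @ x # ys) s \<le> excess Q (xs @ ys) s + (if fst x = s then 1 else 0)"
    by blast+
qed

text \<open>The comparison passes through \<open>xs @ ys\<close>. Removing \<open>x\<close> lowers
  the sum by at most 1 and inserting \<open>y\<close> cannot lower it, so the constant is 1 instead
  of 2.\<close>

lemma sum_excess_bounded_difference:
  assumes "\<And>x. 0 \<le> Q x"
  shows "(\<Sum>s\<in>UNIV. excess Q (xs @ x # ys) s) \<le> (\<Sum>s\<in>UNIV. excess Q (xs @ y # ys) s) + 1"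
proof -
  have "(\<Sum>s\<in>UNIV. excess Q (xs @ x # ys) s) \<le>
        (\<Sum>s\<in>UNIV. excess Q (xs @ ys) s + (if fst x = s then 1 else 0))"
    by (intro sum_mono excess_insert assms)
  also have "\<dots> = (\<Sum>s\<in>UNIV. excess Q (xs @ ys) s) + 1"
    by (simp add: sum.distrib)
  also have "\<dots> \<le> (\<Sum>s\<in>UNIV. excess Q (xs @ y # ys) s) + 1"
    by (intro add_right_mono sum_mono excess_insert assms)
  finally show ?thesis .
qed

section \<open>Total variation distance for a fixed data set\<close>

lemma count_list_le_length_filter_fst:
  "count_list D (s, a) \<le> length (filter (\<lambda>x. fst x = s) D)"
  by (induction D) auto

lemma sum_length_filter_fst:
  "(\<Sum>s\<in>UNIV. real (length (filter (\<lambda>x. fst x = s) D))) = real (length D)"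
  for D :: "('s::finite \<times> 'a) list"
proof (induction D)
  case (Cons x D)
  have "real (length (filter (\<lambda>x. fst x = s) (x # D))) =
      (if fst x = s then 1 else 0) + real (length (filter (\<lambda>x. fst x = s) D))" for s
    by simp
  with Cons show ?case by (simp add: sum.distrib del: filter.simps)
qed simp

text \<open>Grouping the misclassified samples by state allows the training error to be charged
  state by state.\<close>

lemma sum_mismatches:
  "(\<Sum>i<length D. if \<pi> (fst (D ! i)) \<noteq> snd (D ! i) then 1 else 0) =
   (\<Sum>s\<in>UNIV. real (length (filter (\<lambda>x. fst x = s) D)) - real (count_list D (s, \<pi> s)))"
  for D :: "('s::finite \<times> 'a) list"
proof (induction D)
  case (Cons x D)
  have "real (length (filter (\<lambda>x. fst x = s) (x # D))) - real (count_list (x # D) (s, \<pi> s)) =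
      (if fst x = s then if \<pi> (fst x) \<noteq> snd x then 1 else 0 else 0) +
      (real (length (filter (\<lambda>x. fst x = s) D)) - real (count_list D (s, \<pi> s)))" for s
    by (cases x) auto
  with Cons show ?case
    by (simp add: sum.distrib sum.lessThan_Suc_shift del: filter.simps count_list.simps sum.lessThan_Suc)
qed simp

lemma abs_point_mass_minus:
  fixes q :: "'a::finite \<Rightarrow> real"
  assumes "\<And>a. 0 \<le> q a"
  shows "(\<Sum>a\<in>UNIV. \<bar>(if a = b then r else 0) - q a\<bar>) = \<bar>r - q b\<bar> + ((\<Sum>a\<in>UNIV. q a) - q b)"
proof -
  have "(\<Sum>a\<in>UNIV - {b}. \<bar>(if a = b then r else 0) - q a\<bar>) = (\<Sum>a\<in>UNIV - {b}. q a)"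
    by (intro sum.cong) (auto simp: assms)
  then show ?thesis
    by (subst sum.remove[of UNIV b]) (auto simp: sum_diff1)
qed

text \<open>The pathwise part of the argument, in which \<open>r\<close> and \<open>r0\<close> stand
  for the state occupancies of the cloned and the initial policy. The excess does not mention
  \<open>\<pi>\<close>, because it maximises over actions; hence one event will serve all policies
  at once.\<close>

lemma tv_le_excess:
  fixes q :: "'s::finite \<times> 'a::finite \<Rightarrow> real" and D :: "('s \<times> 'a) list"
  assumes "finite_prob q" and D: "length D = N" "N > 0"
  defines "\<rho> \<equiv> \<lambda>s. \<Sum>a\<in>UNIV. q (s, a)"
  shows "tv (\<lambda>(s, a). if a = \<pi> s then r s else 0) q
    \<le> (1/2) * (\<Sum>s\<in>- data_states D. \<rho> s)
      + (1/2) * (\<Sum>s\<in>- data_states D. \<bar>r s - r0 s\<bar>)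
      + (1/2) * (\<Sum>s\<in>- data_states D. \<bar>r0 s - \<rho> s\<bar>)
      + (1/2) * (\<Sum>s\<in>data_states D. \<bar>r s - emp_state D s\<bar>)
      + (1 / real N) * (\<Sum>i<N. if \<pi> (fst (D ! i)) \<noteq> snd (D ! i) then 1 else 0)
      + (\<Sum>s\<in>UNIV. excess (\<lambda>x. real N * q x) D s) / real N"
proof -
  interpret finite_prob q by fact
  define T where "T s = (if s \<in> data_states D then \<bar>r s - emp_state D s\<bar> / 2
    else \<rho> s / 2 + \<bar>r s - r0 s\<bar> / 2 + \<bar>r0 s - \<rho> s\<bar> / 2)" for s
  define m where "m s = real (count_list D (s, \<pi> s)) / real N" for s
  define W where "W s = excess (\<lambda>x. real N * q x) D s / real N" for s
  have q_le: "q (s, a) \<le> \<rho> s" for s a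
    unfolding \<rho>_def by (rule member_le_sum) (auto simp: nonneg)
  have m_le: "m s \<le> emp_state D s" for s
    using D count_list_le_length_filter_fst[of D s "\<pi> s"]
    by (simp add: m_def emp_state_def divide_right_mono)
  \<comment> \<open>The last summand disappears after summation, as \<open>\<rho>\<close> and the empirical distribution have equal mass.\<close>
  have pointwise: "(\<bar>r s - q (s, \<pi> s)\<bar> + (\<rho> s - q (s, \<pi> s))) / 2
    \<le> T s + (emp_state D s - m s) + W s + (\<rho> s - emp_state D s) / 2" for s
  proof (cases "s \<in> data_states D")
    case True
    have "max 0 (real (count_list D (s, \<pi> s)) - real N * q (s, \<pi> s)) \<le> excess (\<lambda>x. real N * q x) D s"
      using True unfolding excess_def by (simp only: if_True) (rule Max_range_geI, rule order.refl)
    then have "max 0 (real (count_list D (s, \<pi> s)) - real N * q (s, \<pi> s)) / real N \<le> W s"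
      using D by (simp add: W_def divide_right_mono)
    moreover have "max 0 (real (count_list D (s, \<pi> s)) - real N * q (s, \<pi> s)) / real N =
        max 0 (m s - q (s, \<pi> s))"
      using D by (simp add: m_def max_def field_simps)
    ultimately have W: "0 \<le> W s" "m s - q (s, \<pi> s) \<le> W s" by simp_all
    \<comment> \<open>If \<open>q (s, \<pi> s)\<close> is at most the empirical state frequency,
      what remains to be shown is \<open>m s - q (s, \<pi> s) \<le> W s\<close>; otherwise
      \<open>0 \<le> W s\<close> and \<open>m_le\<close> suffice.\<close>
    show ?thesis
    proof (cases "q (s, \<pi> s) \<le> emp_state D s")
      case le: True
      have "\<bar>r s - q (s, \<pi> s)\<bar> \<le> \<bar>r s - emp_state D s\<bar> + (emp_state D s - q (s, \<pi> s))"
        using le by linarith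
      with W True show ?thesis unfolding T_def by (simp add: field_simps)
    next
      case False
      then have "\<bar>r s - q (s, \<pi> s)\<bar> \<le> \<bar>r s - emp_state D s\<bar> + (q (s, \<pi> s) - emp_state D s)"
        by linarith
      with W True m_le[of s] show ?thesis unfolding T_def by (simp add: field_simps)
    qed
  next
    case False
    then have e: "emp_state D s = 0" and m: "m s = 0"
      by (auto simp: emp_state_def m_def count_list_eq_0_if_unseen data_states_def filter_empty_conv)
    have "Min (range (\<lambda>a. real N * q (s, a))) \<le> real N * q (s, \<pi> s)"
      by (intro Min_le) auto
    then have "- (real N * q (s, \<pi> s)) \<le> excess (\<lambda>x. real N * q x) D s"
      using False by (simp add: excess_def)
    then have "- q (s, \<pi> s) \<le> W s"
      using D by (simp add: W_def field_simps)
    \<comment> \<open>The term \<open>\<rho> s / 2\<close> in \<open>T s\<close> and the half from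
      the last summand add up to \<open>\<rho> s\<close>, leaving exactly
      \<open>- q (s, \<pi> s) \<le> W s\<close>.\<close>
    moreover have "\<bar>r s - q (s, \<pi> s)\<bar> \<le>
        \<bar>r s - r0 s\<bar> + \<bar>r0 s - \<rho> s\<bar> + (\<rho> s - q (s, \<pi> s))"
      using q_le[of s "\<pi> s"] by linarith
    ultimately show ?thesis using False e m by (simp add: T_def field_simps)
  qed
  have "tv (\<lambda>(s, a). if a = \<pi> s then r s else 0) q =
      (\<Sum>s\<in>UNIV. (\<bar>r s - q (s, \<pi> s)\<bar> + (\<rho> s - q (s, \<pi> s))) / 2)"
  proof -
    have "(\<Sum>x\<in>UNIV. \<bar>(case x of (s, a) \<Rightarrow> if a = \<pi> s then r s else 0) - q x\<bar>) =
        (\<Sum>s\<in>UNIV. \<Sum>a\<in>UNIV. \<bar>(if a = \<pi> s then r s else 0) - q (s, a)\<bar>)"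
      by (simp add: sum.cartesian_product case_prod_unfold)
    then show ?thesis
      by (simp add: tv_def \<rho>_def abs_point_mass_minus nonneg sum_divide_distrib)
  qed
  also have "\<dots> \<le> (\<Sum>s\<in>UNIV. T s + (emp_state D s - m s) + W s + (\<rho> s - emp_state D s) / 2)"
    by (intro sum_mono pointwise)
  also have "\<dots> = (\<Sum>s\<in>UNIV. T s) + (\<Sum>s\<in>UNIV. emp_state D s - m s) + (\<Sum>s\<in>UNIV. W s)
      + ((\<Sum>s\<in>UNIV. \<rho> s) - (\<Sum>s\<in>UNIV. emp_state D s)) / 2"
    by (simp add: sum.distrib sum_subtractf sum_divide_distrib[symmetric] del: sum_divide_distrib)
  also have "(\<Sum>s\<in>UNIV. \<rho> s) = 1"
    using total by (simp add: \<rho>_def sum.cartesian_product case_prod_unfold)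
  also have "(\<Sum>s\<in>UNIV. emp_state D s) = 1"
    using D by (simp add: emp_state_def sum_divide_distrib[symmetric] sum_length_filter_fst)
  also have "(\<Sum>s\<in>UNIV. emp_state D s - m s) =
      (1 / real N) * (\<Sum>i<N. if \<pi> (fst (D ! i)) \<noteq> snd (D ! i) then 1 else 0)"
    using sum_mismatches[of \<pi> D] D
    by (simp add: emp_state_def m_def sum_divide_distrib[symmetric] diff_divide_distrib[symmetric])
  also have "(\<Sum>s\<in>UNIV. T s) =
      (\<Sum>s\<in>data_states D. T s) + (\<Sum>s\<in>- data_states D. T s)"
    by (subst sum.union_disjoint[symmetric]) auto
  finally show ?thesis
    by (simp add: T_def W_def sum.distrib sum_divide_distrib)
qed

section \<open>Elementary inequalities\<close>

lemma ln_2_ge: "0.693 \<le> ln (2::real)"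
  using ln_approx_bounds[of 2 3] by (simp add: eval_nat_numeral)

lemma ln_3_ge: "1.089 \<le> ln (3::real)"
proof -
  have "ln ((2::real) ^ 11) \<le> ln (3 ^ 7)"
    by (subst ln_le_cancel_iff) simp_all
  then have "11 * ln (2::real) \<le> 7 * ln 3"
    by (simp only: ln_realpow of_nat_numeral zero_less_numeral)
  with ln_2_ge show ?thesis by simp
qed

lemma ln_5_ge: "1.55 \<le> ln (5::real)"
proof -
  have "ln ((2::real) ^ 9) \<le> ln (5 ^ 4)"
    by (subst ln_le_cancel_iff) simp_all
  then have "9 * ln (2::real) \<le> 4 * ln 5"
    by (simp only: ln_realpow of_nat_numeral zero_less_numeral)
  with ln_2_ge show ?thesis by simp
qed

text \<open>The left-hand side is the constant from the second moment bound with \<open>k\<close>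
  actions. At \<open>k = 3\<close> it would be 0.5625, against about 0.549 on the right.\<close>

lemma square_ratio_le_half_ln:
  assumes "k \<ge> 4"
  shows "(real k / real (k + 1))\<^sup>2 \<le> ln (real k) / 2"
proof -
  consider "k = 4" | "5 \<le> k" "k \<le> 7" | "8 \<le> k" using assms by linarith
  then show ?thesis
  proof cases
    case 1
    have "ln (4::real) = 2 * ln 2"
      using ln_realpow[of 2 2] by simp
    with 1 ln_2_ge show ?thesis by (simp add: power2_eq_square)
  next
    case 2
    have "(real k / real (k + 1))\<^sup>2 \<le> (7 / 8)\<^sup>2"
      using 2 by (intro power_mono) (auto simp: field_simps)
    moreover have "ln 5 \<le> ln (real k)"
      using 2 by simp
    ultimately show ?thesis using ln_5_ge by (simp add: power2_eq_square)
  next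
    case 3
    have "(real k / real (k + 1))\<^sup>2 \<le> 1\<^sup>2"
      by (intro power_mono) (auto simp: field_simps)
    moreover have "ln (8::real) = 3 * ln 2"
      using ln_realpow[of 2 3] by simp
    moreover have "ln 8 \<le> ln (real k)"
      using 3 by simp
    ultimately show ?thesis using ln_2_ge by simp
  qed
qed

lemma exp_ge_partial_sum:
  fixes x :: real
  assumes "0 \<le> x"
  shows "(\<Sum>k<n. x ^ k / fact k) \<le> exp x"
  using assms summable_exp[of x]
  by (auto simp: exp_def divide_inverse mult.commute intro!: sum_le_suminf)

lemma exp_minus_leI:
  fixes x :: real
  assumes "0 \<le> x" and "1 \<le> c * (\<Sum>k<n. x ^ k / fact k)" and "0 < c"
  shows "exp (- x) \<le> c"
proof -
  have "1 \<le> c * exp x"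
    using assms(2) mult_left_mono[OF exp_ge_partial_sum[OF assms(1), of n], of c] assms(3) by linarith
  then show ?thesis by (simp add: exp_minus field_simps)
qed

lemma exp_minus_bounds:
  "exp (- 1) \<le> (0.36788::real)"
  "exp (- 3) \<le> (0.0498::real)"
  "exp (- 0.4) \<le> (0.67033::real)"
  "exp (- 0.6) \<le> (0.54882::real)"
  "exp (- 0.23) \<le> (0.79454::real)"
  "exp (- 0.69) \<le> (0.50158::real)"
  "exp (- 1.39) \<le> (0.24908::real)"
  by (rule exp_minus_leI[where n = 14]; simp add: eval_nat_numeral)+

text \<open>The function \<open>x * exp (- x)\<close> is concave on \<open>[0, 2]\<close>, so it
  lies below its tangents. This replaces it by linear bounds with one numerical exponential
  each.\<close>

lemma x_exp_minus_le_tangent: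
  fixes x y :: real
  assumes "0 \<le> x" "x \<le> 2" "0 \<le> y" "y \<le> 2"
  shows "x * exp (- x) \<le> exp (- y) * (y + (1 - y) * (x - y))"
proof -
  have "(- (1 - y) * exp (- y)) * (x - y) \<le> - (x * exp (- x)) - - (y * exp (- y))"
  proof (rule f''_imp_f'[where C = "{0..2}" and f = "\<lambda>x. - (x * exp (- x))"
        and f' = "\<lambda>x. - (1 - x) * exp (- x)" and f'' = "\<lambda>x. (2 - x) * exp (- x)"])
    show "((\<lambda>x. - (x * exp (- x))) has_real_derivative - (1 - x) * exp (- x)) (at x)" for x :: real
      by (auto intro!: derivative_eq_intros simp: algebra_simps)
    show "((\<lambda>x. - (1 - x) * exp (- x)) has_real_derivative (2 - x) * exp (- x)) (at x)" for x :: real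
      by (auto intro!: derivative_eq_intros simp: algebra_simps)
  qed (use assms in auto)
  then show ?thesis by (simp add: algebra_simps)
qed

text \<open>The left-hand side is the value of the right-hand side at \<open>N = 2\<close>. With
  \<open>c\<close> the expected number of visits to a state, this bounds the probability of never
  seeing it from below, independently of \<open>N\<close>.\<close>

lemma one_minus_over_power_ge:
  fixes c :: real
  assumes "0 \<le> c" "c \<le> 2" "2 \<le> N"
  shows "(1 - c / 2)\<^sup>2 \<le> (1 - c / real N) ^ N"
proof (cases "c = 2")
  case True
  then show ?thesis using assms by simp
next
  case False
  define y where "y = 1 - c / 2"
  have y: "0 < y" using False assms by (simp add: y_def)
  \<comment> \<open>Weighted AM-GM for the numbers 1 and \<open>y\<close> with weights
    \<open>1 - 2 / N\<close> and \<open>2 / N\<close>.\<close>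
  have "exp ((1 - 2 / real N) *\<^sub>R 0 + (2 / real N) *\<^sub>R ln y)
      \<le> (1 - 2 / real N) * exp 0 + (2 / real N) * exp (ln y)"
    using assms by (intro convex_onD[OF exp_convex]) auto
  also have "\<dots> = 1 - c / real N"
    using y assms by (simp add: y_def field_simps)
  finally have "exp (2 / real N * ln y) ^ N \<le> (1 - c / real N) ^ N"
    by (intro power_mono) auto
  also have "exp (2 / real N * ln y) ^ N = y\<^sup>2"
    using assms y by (simp add: exp_of_nat_mult[symmetric]) (simp add: exp_double power2_eq_square)
  finally show ?thesis by (simp add: y_def)
qed

text \<open>The constant \<open>0.5886\<close> is slightly below \<open>sqrt (ln 2 / 2)\<close>.\<close>

lemma sum_x_exp_minus_le:
  fixes a b :: real
  assumes "0 \<le> b" "b \<le> a" "a \<le> 1"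
  shows "a * exp (- a) + b * exp (- b) - b * (1 - (a + b) / 2)\<^sup>2 \<le> 0.5886 * sqrt (a + b)"
proof -
  define c where "c = a + b"
  define z where "z = sqrt c"
  have c: "0 \<le> c" "c \<le> 2" and z: "0 \<le> z" "z\<^sup>2 = c"
    using assms by (auto simp: c_def z_def)
  \<comment> \<open>Both tangents are taken at the midpoint \<open>c / 2\<close>, so that their
    linear parts cancel on adding.\<close>
  have "a * exp (- a) \<le> exp (- (c / 2)) * (c / 2 + (1 - c / 2) * (a - c / 2))"
    and "b * exp (- b) \<le> exp (- (c / 2)) * (c / 2 + (1 - c / 2) * (b - c / 2))"
    using assms c by (auto intro!: x_exp_minus_le_tangent)
  then have "a * exp (- a) + b * exp (- b) \<le> exp (- (c / 2)) * c"
    unfolding c_def by (simp add: field_simps)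
  also have "\<dots> = z * sqrt (c * exp (- c))"
  proof -
    have "sqrt (exp (- c)) = exp (- (c / 2))"
      by (intro real_sqrt_unique) (simp_all add: exp_double[symmetric])
    moreover have "c = z * z" using z by (simp add: power2_eq_square)
    ultimately show ?thesis using z(1) by (simp add: real_sqrt_mult)
  qed
  finally have sum_le: "a * exp (- a) + b * exp (- b) \<le> z * sqrt (c * exp (- c))" .
  have sq: "0 \<le> b * (1 - c / 2)\<^sup>2" using assms by simp
  have *: ?thesis if "c * exp (- c) \<le> 0.5886\<^sup>2"
  proof -
    have "sqrt (c * exp (- c)) \<le> 0.5886" using that by (intro real_le_lsqrt) auto
    then have "z * sqrt (c * exp (- c)) \<le> z * 0.5886" using z by (intro mult_left_mono)
    with sum_le sq show ?thesis by (simp add: c_def z_def mult.commute)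
  qed
  \<comment> \<open>The maximum of \<open>c * exp (- c)\<close>, at \<open>c = 1\<close>, exceeds
    \<open>0.5886\<^sup>2\<close>, so the midpoint bound alone works only outside
    \<open>[0.69, 1.39]\<close>. Inside, either \<open>b\<close> is large enough for the subtracted
    term to close the gap, or \<open>a\<close> and \<open>b\<close> are so unequal that separate
    tangents do.\<close>
  consider "c \<le> 0.69" | "1.39 \<le> c" | "0.69 \<le> c" "c \<le> 1.39" "0.23 \<le> b" | "0.69 \<le> c" "c \<le> 1.39" "b \<le> 0.23"
    by linarith
  then show ?thesis
  proof cases
    case 1
    have "c * exp (- c) \<le> exp (- 0.69) * (0.69 + (1 - 0.69) * (c - 0.69))"
      using c by (intro x_exp_minus_le_tangent) auto
    also have "\<dots> \<le> exp (- 0.69) * 0.69"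
      using 1 by (intro mult_left_mono) auto
    finally show ?thesis
      using exp_minus_bounds(6) by (intro *) (simp add: power2_eq_square)
  next
    case 2
    have "c * exp (- c) \<le> exp (- 1.39) * (1.39 + (1 - 1.39) * (c - 1.39))"
      using c by (intro x_exp_minus_le_tangent) auto
    also have "\<dots> \<le> exp (- 1.39) * 1.39"
      using 2 by (intro mult_left_mono) auto
    finally show ?thesis
      using exp_minus_bounds(7) by (intro *) (simp add: power2_eq_square)
  next
    case 3
    have "c * exp (- c) \<le> exp (- 1) * (1 + (1 - 1) * (c - 1))"
      using c by (intro x_exp_minus_le_tangent) auto
    also have "\<dots> \<le> 0.60654\<^sup>2"
      using exp_minus_bounds(1) by (simp add: power2_eq_square)
    finally have "sqrt (c * exp (- c)) \<le> 0.60654"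
      by (intro real_le_lsqrt) auto
    then have "z * sqrt (c * exp (- c)) \<le> z * 0.60654" using z by (intro mult_left_mono)
    moreover have "0.23 * (1 - 1.39 / 2)\<^sup>2 \<le> b * (1 - c / 2)\<^sup>2"
      using 3 assms by (intro mult_mono power_mono) auto
    moreover have "z \<le> 1.18"
      using 3 unfolding z_def by (intro real_le_lsqrt) (auto simp: power2_eq_square)
    ultimately show ?thesis using sum_le unfolding c_def[symmetric] z_def[symmetric]
      by (simp add: power2_eq_square)
  next
    case 4
    have "a * exp (- a) \<le> exp (- 0.6) * (0.6 + (1 - 0.6) * (a - 0.6))"
      using assms by (intro x_exp_minus_le_tangent) auto
    also have "\<dots> \<le> 0.54882 * (0.6 + (1 - 0.6) * (a - 0.6))"
      using exp_minus_bounds(4) assms by (intro mult_right_mono) (simp_all add: field_simps)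
    finally have a: "a * exp (- a) \<le> 0.54882 * (0.6 + (1 - 0.6) * (a - 0.6))" .
    have "b * exp (- b) \<le> exp (- 0.23) * (0.23 + (1 - 0.23) * (b - 0.23))"
      using assms by (intro x_exp_minus_le_tangent) auto
    also have "\<dots> \<le> 0.79454 * (0.23 + (1 - 0.23) * (b - 0.23))"
      using exp_minus_bounds(5) assms by (intro mult_right_mono) (simp_all add: field_simps)
    finally have "a * exp (- a) + b * exp (- b) \<le> 0.3299 + 0.21953 * c"
      using a 4 assms unfolding c_def by (simp add: field_simps)
    also have "\<dots> \<le> 0.5886 * z"
    proof -
      have "z \<le> 1.18"
        using 4 unfolding z_def by (intro real_le_lsqrt) (auto simp: power2_eq_square)
      moreover have "0.83 \<le> z"
        using 4 unfolding z_def by (intro real_le_rsqrt) (auto simp: power2_eq_square)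
      \<comment> \<open>The chord of the square function on \<open>[0.83, 1.18]\<close> bounds
        \<open>c = z\<^sup>2\<close> by a linear function of \<open>z\<close>.\<close>
      ultimately have "0 \<le> (z - 0.83) * (1.18 - z)" by simp
      then have "c \<le> 2.01 * z - 0.9794"
        unfolding z(2)[symmetric] by (simp add: power2_eq_square field_simps)
      with \<open>0.83 \<le> z\<close> show ?thesis by simp
    qed
    finally show ?thesis using sq by (simp add: c_def z_def)
  qed
qed

text \<open>The mixed case for two actions: one expected count is above 1, the other below.\<close>

lemma sqrt_plus_x_exp_minus_le:
  fixes a b :: real
  assumes "1 \<le> a" "0 \<le> b" "b \<le> 1"
  shows "0.41 * sqrt a + b * exp (- b) \<le> 0.5886 * sqrt (a + b)"
proof -
  define u v where "u = sqrt a" and "v = sqrt b"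
  have u: "1 \<le> u" "u\<^sup>2 = a" and v: "0 \<le> v" "v \<le> 1" "v\<^sup>2 = b"
    using assms by (auto simp: u_def v_def)
  \<comment> \<open>The constants are close to \<open>0.5886 * 0.8164 - 0.41\<close> and
    \<open>0.5886 * 0.5773\<close>, what the final estimate below leaves for \<open>v\<close> when
    \<open>u = 1\<close>. Each range of \<open>v\<close> combines a tangent with a chord or a
    trivial estimate.\<close>
  have b: "b * exp (- b) \<le> 0.0705 + 0.3398 * v"
  proof -
    consider "v \<le> 0.2" | "0.2 \<le> v" "v \<le> 0.633" | "0.633 \<le> v" "v \<le> 0.915" | "0.915 \<le> v"
      by linarith
    then show ?thesis
    proof cases
      case 1
      have "b * exp (- b) \<le> b * 1"
        using assms by (intro mult_left_mono) auto
      also have "b \<le> 0.2\<^sup>2" using 1 v power_mono[of v "0.2" 2] by simp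
      finally show ?thesis using v by (simp add: power2_eq_square)
    next
      case 2
      have "b * exp (- b) \<le> exp (- 0.4) * (0.4 + (1 - 0.4) * (b - 0.4))"
        using assms by (intro x_exp_minus_le_tangent) auto
      also have "\<dots> \<le> 0.67033 * (0.4 + (1 - 0.4) * (b - 0.4))"
        using exp_minus_bounds(3) assms by (intro mult_right_mono) (simp_all add: field_simps)
      also have "0 \<le> (v - 0.2) * (0.633 - v)" using 2 by simp
      then have "b \<le> 0.833 * v - 0.1266"
        using v by (simp add: field_simps power2_eq_square)
      then have "0.67033 * (0.4 + (1 - 0.4) * (b - 0.4)) \<le> 0.0705 + 0.3398 * v"
        using 2 by (simp add: field_simps)
      finally show ?thesis .
    next
      case 3
      have "b * exp (- b) \<le> exp (- 0.6) * (0.6 + (1 - 0.6) * (b - 0.6))"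
        using assms by (intro x_exp_minus_le_tangent) auto
      also have "\<dots> \<le> 0.54882 * (0.6 + (1 - 0.6) * (b - 0.6))"
        using exp_minus_bounds(4) assms by (intro mult_right_mono) (simp_all add: field_simps)
      also have "0 \<le> (v - 0.633) * (0.915 - v)" using 3 by simp
      then have "b \<le> 1.548 * v - 0.579195"
        using v by (simp add: field_simps power2_eq_square)
      then have "0.54882 * (0.6 + (1 - 0.6) * (b - 0.6)) \<le> 0.0705 + 0.3398 * v"
        using 3 by (simp add: field_simps)
      finally show ?thesis .
    next
      case 4
      have "b * exp (- b) \<le> exp (- 1) * (1 + (1 - 1) * (b - 1))"
        using assms by (intro x_exp_minus_le_tangent) auto
      with exp_minus_bounds(1) 4 show ?thesis by simp
    qed
  qed
  \<comment> \<open>Cauchy-Schwarz against a vector of length just below 1, close to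
    \<open>(sqrt (2/3), sqrt (1/3))\<close>.\<close>
  have "(0.8164 * u + 0.5773 * v)\<^sup>2 \<le> a + b"
  proof -
    have "0 \<le> (0.5773 * u - 0.8164 * v)\<^sup>2" by simp
    then have "2 * (0.8164 * 0.5773) * (u * v) \<le> 0.5773\<^sup>2 * a + 0.8164\<^sup>2 * b"
      unfolding u(2)[symmetric] v(3)[symmetric] by (simp add: power2_eq_square algebra_simps)
    moreover have "(0.8164 * u + 0.5773 * v)\<^sup>2 =
        0.8164\<^sup>2 * a + 0.5773\<^sup>2 * b + 2 * (0.8164 * 0.5773) * (u * v)"
      unfolding u(2)[symmetric] v(3)[symmetric] by (simp add: power2_eq_square algebra_simps)
    ultimately show ?thesis using assms by (simp add: power2_eq_square)
  qed
  then have "0.8164 * u + 0.5773 * v \<le> sqrt (a + b)"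
    by (rule real_le_rsqrt)
  then show ?thesis using b u v by (simp add: u_def[symmetric])
qed

section \<open>Mean deviation of the binomial distribution\<close>

text \<open>De Moivre's formula for the mean absolute deviation of the binomial distribution.\<close>

lemma binomial_partial_deviation:
  fixes p :: real
  assumes "J \<le> N"
  shows "(\<Sum>j\<le>J. (real N * p - real j) * (real (N choose j) * p ^ j * (1 - p) ^ (N - j))) =
    real (N - J) * real (N choose J) * p ^ (J + 1) * (1 - p) ^ (N - J)"
  using assms
proof (induction J)
  case (Suc J)
  have "Suc J * (N choose Suc J) = (N - J) * (N choose J)"
    by (metis Suc.prems binomial_absorb_comp binomial_absorption)
  then have C: "real (Suc J) * real (N choose Suc J) = real (N - J) * real (N choose J)"
    by (metis of_nat_mult)
  have pow: "(1 - p) ^ (N - J) = (1 - p) * (1 - p) ^ (N - Suc J)"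
    using Suc.prems by (metis Suc_diff_Suc Suc_le_lessD power_Suc)
  have "(\<Sum>j\<le>Suc J. (real N * p - real j) * (real (N choose j) * p ^ j * (1 - p) ^ (N - j))) =
      real (N - J) * real (N choose J) * p ^ (J + 1) * (1 - p) ^ (N - J) +
      (real N * p - real (Suc J)) * (real (N choose Suc J) * p ^ Suc J * (1 - p) ^ (N - Suc J))"
    using Suc by simp
  also have "\<dots> = (real (Suc J) * real (N choose Suc J)) * p ^ (J + 1) * ((1 - p) * (1 - p) ^ (N - Suc J)) +
      (real N * p - real (Suc J)) * (real (N choose Suc J) * p ^ Suc J * (1 - p) ^ (N - Suc J))"
    unfolding C pow ..
  also have "\<dots> = (real N - real (Suc J)) * real (N choose Suc J) * p ^ (Suc J + 1) * (1 - p) ^ (N - Suc J)"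
    by (simp add: algebra_simps)
  also have "real N - real (Suc J) = real (N - Suc J)"
    using Suc.prems by simp
  finally show ?case .
qed simp

text \<open>
  This is the case \<open>Q = \<nu>\<close> of the comparison of the binomial with the Poisson mean deviation, in
  denominator-free form; consecutive values of \<open>\<nu>\<close> differ by a factor \<open>(1 - 1/a)^a \<le> exp (- 1)\<close>.
\<close>

lemma falling_factorial_power_le:
  assumes "\<nu> \<le> N" "N > 0"
  shows "real (N - \<nu>) * real (N choose \<nu>) * fact \<nu> * real (N - \<nu>) ^ (N - \<nu>)
    \<le> real N ^ (N + 1) * exp (- real \<nu>)"
  using assms(1)
proof (induction \<nu>)
  case 0
  then show ?case by simp
next
  case (Suc \<nu>)
  define a where "a = N - \<nu>"
  have a: "a > 0" "N - Suc \<nu> = a - 1" using Suc.prems by (auto simp: a_def)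
  have "Suc \<nu> * (N choose Suc \<nu>) = (N - \<nu>) * (N choose \<nu>)"
    by (metis Suc.prems binomial_absorb_comp binomial_absorption)
  then have C: "real (Suc \<nu>) * real (N choose Suc \<nu>) = real a * real (N choose \<nu>)"
    unfolding a_def by (metis of_nat_mult)
  have "real (N - Suc \<nu>) * real (N choose Suc \<nu>) * fact (Suc \<nu>) * real (N - Suc \<nu>) ^ (N - Suc \<nu>) =
      (real (Suc \<nu>) * real (N choose Suc \<nu>)) * fact \<nu> * (real (a - 1) * real (a - 1) ^ (a - 1))"
    unfolding a(2) by (simp add: mult_ac)
  also have "real (a - 1) * real (a - 1) ^ (a - 1) = real (a - 1) ^ a"
    using a(1) by (simp add: power_eq_if)
  also have "(real (Suc \<nu>) * real (N choose Suc \<nu>)) * fact \<nu> * real (a - 1) ^ a =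
      real a * real (N choose \<nu>) * fact \<nu> * (real a ^ a * (1 - 1 / real a) ^ a)"
    unfolding C using a(1) by (simp add: power_mult_distrib[symmetric] field_simps)
  also have "\<dots> \<le> real a * real (N choose \<nu>) * fact \<nu> * (real a ^ a * exp (- 1))"
    using a(1) by (intro mult_left_mono exp_ge_one_minus_x_over_n_power_n) auto
  also have "\<dots> = (real (N - \<nu>) * real (N choose \<nu>) * fact \<nu> * real (N - \<nu>) ^ (N - \<nu>)) * exp (- 1)"
    by (simp add: a_def)
  also have "\<dots> \<le> (real N ^ (N + 1) * exp (- real \<nu>)) * exp (- 1)"
    using Suc by (intro mult_right_mono) auto
  also have "\<dots> = real N ^ (N + 1) * exp (- real (Suc \<nu>))"
    by (simp add: exp_add[symmetric])
  finally show ?case .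
qed

text \<open>Half the mean absolute deviation of a binomial variable. The lower deviation is chosen
  because its nonzero terms form an initial segment in \<open>j\<close>, which has a closed
  form.\<close>

definition binomial_dev :: "nat \<Rightarrow> real \<Rightarrow> real" where
  "binomial_dev N p =
     (\<Sum>j\<le>N. real (N choose j) * p ^ j * (1 - p) ^ (N - j) * max 0 (real N * p - real j))"

text \<open>The right-hand side is the same deviation for the Poisson distribution with mean
  \<open>Q\<close>. At an integer \<open>Q\<close> both admissible values of \<open>\<nu>\<close>
  give the same bound.\<close>

lemma binomial_dev_le_Poisson:
  assumes p: "0 \<le> p" "p \<le> 1" and N: "N > 0"
    and \<nu>: "real \<nu> \<le> real N * p" "real N * p \<le> real \<nu> + 1" "\<nu> \<le> N"
  defines "Q \<equiv> real N * p"
  shows "binomial_dev N p \<le> Q ^ (\<nu> + 1) * exp (- Q) / fact \<nu>"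
proof -
  have "binomial_dev N p =
      (\<Sum>j\<le>\<nu>. (Q - real j) * (real (N choose j) * p ^ j * (1 - p) ^ (N - j)))"
    unfolding binomial_dev_def
    using \<nu> by (intro sum.mono_neutral_cong_right) (auto simp: Q_def max_def)
  also have "\<dots> = real (N - \<nu>) * real (N choose \<nu>) * p ^ (\<nu> + 1) * (1 - p) ^ (N - \<nu>)"
    unfolding Q_def by (rule binomial_partial_deviation) fact
  also have "\<dots> \<le> Q ^ (\<nu> + 1) * exp (- Q) / fact \<nu>"
  proof (cases "\<nu> = N")
    case True
    then show ?thesis using p by (simp add: Q_def)
  next
    case False
    define a where "a = N - \<nu>"
    have a: "a > 0" "N = \<nu> + a" using False \<nu> by (auto simp: a_def)
    have "1 - (Q - real \<nu>) / real a = (real N - Q) / real a"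
      using a by (simp add: field_simps)
    \<comment> \<open>This splits off the value of \<open>1 - p\<close> at \<open>Q = \<nu>\<close>;
      the other factor costs at most \<open>exp (- (Q - \<nu>))\<close> after taking the
      power.\<close>
    then have "1 - p = real a / real N * (1 - (Q - real \<nu>) / real a)"
      using a(1) N by (simp add: Q_def field_simps)
    then have "(1 - p) ^ a = (real a / real N) ^ a * (1 - (Q - real \<nu>) / real a) ^ a"
      by (simp only: power_mult_distrib)
    also have "\<dots> \<le> (real a / real N) ^ a * exp (- (Q - real \<nu>))"
      using \<nu> a p N by (intro mult_left_mono exp_ge_one_minus_x_over_n_power_n)
        (auto simp: Q_def intro: order.trans[OF mult_left_le])
    finally have pow: "(1 - p) ^ a \<le> (real a / real N) ^ a * exp (- (Q - real \<nu>))" .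
    have "real a * real (N choose \<nu>) * p ^ (\<nu> + 1) * (1 - p) ^ a \<le>
        real a * real (N choose \<nu>) * p ^ (\<nu> + 1) * ((real a / real N) ^ a * exp (- (Q - real \<nu>)))"
      using p by (intro mult_left_mono pow) auto
    also have "\<dots> = (real a * real (N choose \<nu>) * fact \<nu> * real a ^ a) *
        (p ^ (\<nu> + 1) / fact \<nu> / real N ^ a * exp (- (Q - real \<nu>)))"
      by (simp add: power_divide field_simps)
    also have "\<dots> \<le> (real N ^ (N + 1) * exp (- real \<nu>)) *
        (p ^ (\<nu> + 1) / fact \<nu> / real N ^ a * exp (- (Q - real \<nu>)))"
      using falling_factorial_power_le[of \<nu> N] \<nu> N p
      by (intro mult_right_mono) (auto simp: a_def)
    also have "\<dots> = (p ^ (\<nu> + 1) * (real N ^ (N + 1) / real N ^ a)) / fact \<nu> *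
        (exp (- real \<nu>) * exp (- (Q - real \<nu>)))"
      by (simp add: mult_ac)
    also have "real N ^ (N + 1) / real N ^ a = real N ^ (\<nu> + 1)"
      using a N by (simp add: power_add)
    also have "exp (- real \<nu>) * exp (- (Q - real \<nu>)) = exp (- Q)"
      by (simp add: exp_add[symmetric])
    finally show ?thesis
      by (simp add: a_def Q_def power_mult_distrib mult_ac)
  qed
  finally show ?thesis .
qed

text \<open>Right minus left vanishes at 0 and has derivative \<open>- ln (1 - y\<^sup>2)\<close>,
  which is nonnegative.\<close>

lemma xlnx_symmetric_difference_le:
  fixes x :: real
  assumes "0 \<le> x" "x < 1"
  shows "(1 + x) * ln (1 + x) - (1 - x) * ln (1 - x) \<le> 2 * x"
proof -
  define h where "h x = 2 * x - (1 + x) * ln (1 + x) + (1 - x) * ln (1 - x)" for x :: real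
  have "h 0 \<le> h x"
  proof (rule DERIV_nonneg_imp_nondecreasing[OF assms(1)])
    fix y :: real assume y: "0 \<le> y" "y \<le> x"
    have "(h has_real_derivative - ln ((1 + y) * (1 - y))) (at y)"
      unfolding h_def using y assms
      by (auto intro!: derivative_eq_intros simp: ln_mult)
    moreover have "(1 + y) * (1 - y) \<le> 1" "0 < (1 + y) * (1 - y)"
      using y assms by (simp add: algebra_simps, intro mult_pos_pos) auto
    then have "0 \<le> - ln ((1 + y) * (1 - y))" by simp
    ultimately show "\<exists>z. (h has_real_derivative z) (at y) \<and> 0 \<le> z" by blast
  qed
  then show ?thesis by (simp add: h_def)
qed

text \<open>
  The left-hand side is the maximum over \<open>Q\<close> of \<open>(Q ^ (\<nu> + 1) * exp (- Q) / fact \<nu>)\<^sup>2 / Q\<close>, attained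
  at \<open>Q = \<nu> + 1/2\<close>; it decreases in \<open>\<nu>\<close>.
\<close>

lemma half_integer_power_fact_le:
  assumes "\<nu> \<ge> 1"
  shows "(real \<nu> + 1/2) ^ (2 * \<nu> + 1) * exp (- (2 * real \<nu> + 1)) / (fact \<nu>)\<^sup>2 \<le> 0.1681"
  using assms
proof (induction \<nu> rule: nat_induct_at_least)
  case base
  then show ?case using exp_minus_bounds(2) by (simp add: eval_nat_numeral)
next
  case (Suc \<nu>)
  define m where "m = real \<nu> + 1"
  have m: "m \<ge> 2" using Suc by (simp add: m_def)
  \<comment> \<open>The choice \<open>x = 1 / (2 * m)\<close> compares the powers of
    \<open>m + 1/2\<close> and \<open>m - 1/2\<close> that occur for consecutive
    \<open>\<nu>\<close>.\<close>
  have "(1 + 1 / (2 * m)) * ln (1 + 1 / (2 * m)) - (1 - 1 / (2 * m)) * ln (1 - 1 / (2 * m))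
      \<le> 2 * (1 / (2 * m))"
    using m by (intro xlnx_symmetric_difference_le) auto
  then have "(2 * m) * ((1 + 1 / (2 * m)) * ln (1 + 1 / (2 * m)) - (1 - 1 / (2 * m)) * ln (1 - 1 / (2 * m)))
      \<le> (2 * m) * (2 * (1 / (2 * m)))"
    using m by (intro mult_left_mono) auto
  then have *: "(2 * m + 1) * ln (1 + 1 / (2 * m)) - (2 * m - 1) * ln (1 - 1 / (2 * m)) \<le> 2"
    using m by (simp add: algebra_simps)
  have "1 + 1 / (2 * m) = (m + 1/2) / m" "1 - 1 / (2 * m) = (m - 1/2) / m"
    using m by (auto simp: field_simps)
  then have lns: "ln (1 + 1 / (2 * m)) = ln (m + 1/2) - ln m" "ln (1 - 1 / (2 * m)) = ln (m - 1/2) - ln m"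
    using m by (simp_all only: ln_div)
      (auto simp: ln_div)
  have **: "(2 * m + 1) * ln (m + 1/2) \<le> 2 + 2 * ln m + (2 * m - 1) * ln (m - 1/2)"
    using * unfolding lns by (simp add: algebra_simps)
  have e: "2 * m + 1 = real (2 * Suc \<nu> + 1)" "2 * m - 1 = real (2 * \<nu> + 1)"
    by (simp_all add: m_def)
  have "(m + 1/2) ^ (2 * Suc \<nu> + 1) = exp ((2 * m + 1) * ln (m + 1/2))"
    unfolding e exp_of_nat_mult using m by (simp del: power_Suc)
  also have "\<dots> \<le> exp (2 + 2 * ln m + (2 * m - 1) * ln (m - 1/2))"
    using ** by simp
  also have "\<dots> = exp 2 * m\<^sup>2 * (m - 1/2) ^ (2 * \<nu> + 1)"
    unfolding e exp_add exp_of_nat_mult using m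
    by (simp add: exp_double del: power_Suc)
  finally have step: "(m + 1/2) ^ (2 * Suc \<nu> + 1) \<le> exp 2 * m\<^sup>2 * (m - 1/2) ^ (2 * \<nu> + 1)" .
  have "(real (Suc \<nu>) + 1/2) ^ (2 * Suc \<nu> + 1) * exp (- (2 * real (Suc \<nu>) + 1)) / (fact (Suc \<nu>))\<^sup>2
      = (m + 1/2) ^ (2 * Suc \<nu> + 1) * (exp (- (2 * m + 1)) / (m\<^sup>2 * (fact \<nu>)\<^sup>2))"
    by (simp add: m_def power_mult_distrib add_ac)
  also have "\<dots> \<le> exp 2 * m\<^sup>2 * (m - 1/2) ^ (2 * \<nu> + 1) * (exp (- (2 * m + 1)) / (m\<^sup>2 * (fact \<nu>)\<^sup>2))"
    by (intro mult_right_mono step) auto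
  also have "\<dots> = (m - 1/2) ^ (2 * \<nu> + 1) * (exp 2 * exp (- (2 * m + 1))) / (fact \<nu>)\<^sup>2"
    using m by (simp add: field_simps)
  also have "exp 2 * exp (- (2 * m + 1)) = exp (- (2 * real \<nu> + 1))"
    by (simp add: exp_add[symmetric] m_def)
  also have "m - 1/2 = real \<nu> + 1/2" by (simp add: m_def)
  finally have "(real (Suc \<nu>) + 1/2) ^ (2 * Suc \<nu> + 1) * exp (- (2 * real (Suc \<nu>) + 1)) / (fact (Suc \<nu>))\<^sup>2
      \<le> (real \<nu> + 1/2) ^ (2 * \<nu> + 1) * exp (- (2 * real \<nu> + 1)) / (fact \<nu>)\<^sup>2" .
  from order.trans[OF this Suc.IH] show ?case .
qed

text \<open>After squaring and dividing by \<open>Q\<close>, the inequality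
  \<open>1 + x \<le> exp x\<close> moves \<open>Q\<close> to the maximiser \<open>s\<close>, where
  the previous lemma applies; its constant is \<open>0.41\<^sup>2\<close>.\<close>

lemma Poisson_dev_le_sqrt:
  assumes "\<nu> \<ge> 1" "0 \<le> Q"
  shows "Q ^ (\<nu> + 1) * exp (- Q) / fact \<nu> \<le> 0.41 * sqrt Q"
proof -
  define s where "s = real \<nu> + 1/2"
  have s: "s > 0" "real (2 * \<nu> + 1) = 2 * s" by (auto simp: s_def)
  have "Q / s \<le> exp ((Q - s) / s)"
    using exp_ge_add_one_self[of "(Q - s) / s"] s by (simp add: diff_divide_distrib)
  then have "(Q / s) ^ (2 * \<nu> + 1) \<le> exp ((Q - s) / s) ^ (2 * \<nu> + 1)"
    using assms s by (intro power_mono) auto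
  also have "\<dots> = exp (2 * Q - 2 * s)"
    unfolding exp_of_nat_mult[symmetric] s(2) using s(1) by (simp add: field_simps)
  finally have "Q ^ (2 * \<nu> + 1) \<le> s ^ (2 * \<nu> + 1) * exp (2 * Q - 2 * s)"
    using s by (simp add: power_divide field_simps del: power_Suc)
  then have "Q ^ (2 * \<nu> + 1) * exp (- (2 * Q)) / (fact \<nu>)\<^sup>2 \<le>
      s ^ (2 * \<nu> + 1) * exp (2 * Q - 2 * s) * exp (- (2 * Q)) / (fact \<nu>)\<^sup>2"
    by (intro divide_right_mono mult_right_mono) auto
  also have "\<dots> = s ^ (2 * \<nu> + 1) * exp (- (2 * s)) / (fact \<nu>)\<^sup>2"
    by (simp add: exp_add[symmetric] mult.assoc del: power_Suc)
  also have "\<dots> \<le> 0.1681"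
    using half_integer_power_fact_le[OF assms(1)] by (simp add: s_def add.commute del: power_Suc)
  finally have "Q ^ (2 * \<nu> + 1) * exp (- (2 * Q)) / (fact \<nu>)\<^sup>2 \<le> 0.41\<^sup>2"
    by (simp add: power2_eq_square)
  then have "Q * (Q ^ (2 * \<nu> + 1) * exp (- (2 * Q)) / (fact \<nu>)\<^sup>2) \<le> Q * 0.41\<^sup>2"
    using assms by (intro mult_left_mono)
  also have "Q * (Q ^ (2 * \<nu> + 1) * exp (- (2 * Q)) / (fact \<nu>)\<^sup>2) = (Q ^ (\<nu> + 1) * exp (- Q) / fact \<nu>)\<^sup>2"
  proof -
    have "Q * Q ^ (2 * \<nu> + 1) = Q ^ ((\<nu> + 1) * 2)" by (simp add: mult.commute[of \<nu>])
    then have "Q * Q ^ (2 * \<nu> + 1) = (Q ^ (\<nu> + 1))\<^sup>2" by (simp only: power_mult)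
    moreover have "exp (- (2 * Q)) = (exp (- Q))\<^sup>2"
      using exp_double[of "- Q"] by simp
    ultimately show ?thesis
      by (simp only: power_divide power_mult_distrib times_divide_eq_right mult.assoc[symmetric])
  qed
  also have "Q * 0.41\<^sup>2 = (0.41 * sqrt Q)\<^sup>2"
    using assms by (simp add: power_mult_distrib power_divide)
  finally have "(Q ^ (\<nu> + 1) * exp (- Q) / fact \<nu>)\<^sup>2 \<le> (0.41 * sqrt Q)\<^sup>2" .
  then show ?thesis by (rule power2_le_imp_le) (use assms in auto)
qed

lemma binomial_dev_le:
  assumes p: "0 \<le> p" "p \<le> 1" and N: "N > 0"
  defines "Q \<equiv> real N * p"
  shows "Q \<le> 1 \<Longrightarrow> binomial_dev N p \<le> Q * exp (- Q)"
    and "1 \<le> Q \<Longrightarrow> binomial_dev N p \<le> 0.41 * sqrt Q"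
proof -
  assume "Q \<le> 1"
  then show "binomial_dev N p \<le> Q * exp (- Q)"
    using binomial_dev_le_Poisson[OF p N, of 0] p by (simp add: Q_def)
next
  assume Q: "1 \<le> Q"
  define \<nu> where "\<nu> = nat \<lfloor>Q\<rfloor>"
  have \<nu>: "real \<nu> \<le> Q" "Q \<le> real \<nu> + 1" "\<nu> \<ge> 1"
    using Q by (auto simp: \<nu>_def le_nat_iff)
  have "Q \<le> real N" unfolding Q_def using p by (simp add: mult_left_le)
  with \<nu> have "\<nu> \<le> N" by linarith
  then have "binomial_dev N p \<le> Q ^ (\<nu> + 1) * exp (- Q) / fact \<nu>"
    using binomial_dev_le_Poisson[OF p N, of \<nu>] \<nu> unfolding Q_def by blast
  also have "\<dots> \<le> 0.41 * sqrt Q"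
    using Poisson_dev_le_sqrt[of \<nu> Q] \<nu> Q by linarith
  finally show "binomial_dev N p \<le> 0.41 * sqrt Q" .
qed

text \<open>The subtracted term is the saving at an unseen state times the probability that the
  state is unseen. The cases follow whether the expected counts exceed 1; the saving is exploited
  only when neither does.\<close>

lemma binomial_dev_pair_le_aux:
  assumes p: "0 \<le> p2" "p2 \<le> p1" "p1 + p2 \<le> 1" and N: "N \<ge> 2"
  shows "binomial_dev N p1 + binomial_dev N p2 - min 1 (real N * p2) * (1 - (p1 + p2)) ^ N
    \<le> 0.5886 * sqrt (real N * (p1 + p2))"
proof -
  define a b where "a = real N * p1" and "b = real N * p2"
  have ab: "0 \<le> b" "b \<le> a" using p by (auto simp: a_def b_def intro: mult_left_mono)
  have c: "real N * (p1 + p2) = a + b" by (simp add: a_def b_def algebra_simps)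
  have pw: "0 \<le> min 1 b * (1 - (p1 + p2)) ^ N" using p ab by simp
  note dev = binomial_dev_le[of p1 N, folded a_def] binomial_dev_le[of p2 N, folded b_def]
  consider "1 \<le> b" | "b \<le> 1" "1 \<le> a" | "a \<le> 1" by linarith
  then have "binomial_dev N p1 + binomial_dev N p2 - min 1 b * (1 - (p1 + p2)) ^ N
      \<le> 0.5886 * sqrt (a + b)"
  proof cases
    case 1
    \<comment> \<open>For equal counts the constant is \<open>0.41 * sqrt 2\<close>, about
      0.58.\<close>
    have "(0.41 * sqrt a + 0.41 * sqrt b)\<^sup>2 \<le> (0.5886 * sqrt (a + b))\<^sup>2"
    proof -
      have "0 \<le> (sqrt a - sqrt b)\<^sup>2" by simp
      then have "2 * (sqrt a * sqrt b) \<le> a + b"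
        using ab by (simp add: power2_eq_square algebra_simps)
      moreover have e1: "(0.41 * sqrt a + 0.41 * sqrt b)\<^sup>2 = 0.1681 * (a + b + 2 * (sqrt a * sqrt b))"
        using ab by (simp add: power2_eq_square algebra_simps)
      moreover have e2: "(0.5886 * sqrt (a + b))\<^sup>2 = 0.34644996 * (a + b)"
        using ab by (simp add: power_mult_distrib) (simp add: power2_eq_square)
      ultimately show ?thesis unfolding e1 e2 using ab by simp
    qed
    then have "0.41 * sqrt a + 0.41 * sqrt b \<le> 0.5886 * sqrt (a + b)"
      by (rule power2_le_imp_le) (use ab in auto)
    moreover have "binomial_dev N p1 \<le> 0.41 * sqrt a" "binomial_dev N p2 \<le> 0.41 * sqrt b"
      using dev(2,4) 1 p N ab by simp_all
    ultimately show ?thesis using pw by linarith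
  next
    case 2
    then have "binomial_dev N p1 \<le> 0.41 * sqrt a" "binomial_dev N p2 \<le> b * exp (- b)"
      using dev(2,3) p N ab by simp_all
    with 2 ab pw sqrt_plus_x_exp_minus_le[of a b] show ?thesis by linarith
  next
    case 3
    have "b * (1 - (a + b) / 2)\<^sup>2 \<le> b * (1 - (a + b) / real N) ^ N"
      using ab 3 N by (intro mult_left_mono one_minus_over_power_ge) auto
    also have "1 - (a + b) / real N = 1 - (p1 + p2)"
      using N by (simp add: a_def b_def field_simps)
    finally show ?thesis
      using sum_x_exp_minus_le[of b a] dev(1,3) p N ab 3 by simp
  qed
  then show ?thesis unfolding c b_def .
qed

lemma binomial_dev_pair_le:
  assumes p: "0 \<le> p1" "0 \<le> p2" "p1 + p2 \<le> 1" and N: "N \<ge> 2"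
  shows "binomial_dev N p1 + binomial_dev N p2 -
      min 1 (min (real N * p1) (real N * p2)) * (1 - (p1 + p2)) ^ N
    \<le> 0.5886 * sqrt (real N * (p1 + p2))"
proof (cases "p2 \<le> p1")
  case True
  then have "min (real N * p1) (real N * p2) = real N * p2" by (simp add: mult_left_mono)
  with binomial_dev_pair_le_aux[of p2 p1 N] True p N show ?thesis by simp
next
  case False
  then have "min (real N * p1) (real N * p2) = real N * p1" by (simp add: mult_left_mono)
  with binomial_dev_pair_le_aux[of p1 p2 N] False p N show ?thesis by (simp add: add.commute)
qed

section \<open>The expected excess\<close>

text \<open>Pascal's rule, read as conditioning on the first of \<open>Suc N\<close> trials.\<close>

lemma binomial_sum_Suc:
  fixes p :: real
  shows "(\<Sum>j\<le>Suc N. real (Suc N choose j) * p ^ j * (1 - p) ^ (Suc N - j) * \<phi> j) =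
    p * (\<Sum>j\<le>N. real (N choose j) * p ^ j * (1 - p) ^ (N - j) * \<phi> (Suc j)) +
    (1 - p) * (\<Sum>j\<le>N. real (N choose j) * p ^ j * (1 - p) ^ (N - j) * \<phi> j)"
proof -
  have "(\<Sum>j\<le>Suc N. real (Suc N choose j) * p ^ j * (1 - p) ^ (Suc N - j) * \<phi> j) =
      (1 - p) ^ Suc N * \<phi> 0 +
      (\<Sum>j\<le>N. real (Suc N choose Suc j) * p ^ Suc j * (1 - p) ^ (N - j) * \<phi> (Suc j))"
    by (subst sum.atMost_Suc_shift) simp
  also have "(\<Sum>j\<le>N. real (Suc N choose Suc j) * p ^ Suc j * (1 - p) ^ (N - j) * \<phi> (Suc j)) =
      p * (\<Sum>j\<le>N. real (N choose j) * p ^ j * (1 - p) ^ (N - j) * \<phi> (Suc j)) +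
      (\<Sum>j\<le>N. real (N choose Suc j) * p ^ Suc j * (1 - p) ^ (N - j) * \<phi> (Suc j))"
    by (simp add: sum_distrib_left sum.distrib[symmetric] algebra_simps)
  also have "(1 - p) ^ Suc N * \<phi> 0 + (p * (\<Sum>j\<le>N. real (N choose j) * p ^ j * (1 - p) ^ (N - j) * \<phi> (Suc j)) +
      (\<Sum>j\<le>N. real (N choose Suc j) * p ^ Suc j * (1 - p) ^ (N - j) * \<phi> (Suc j))) =
      p * (\<Sum>j\<le>N. real (N choose j) * p ^ j * (1 - p) ^ (N - j) * \<phi> (Suc j)) +
      (\<Sum>j\<le>Suc N. real (N choose j) * p ^ j * (1 - p) ^ (Suc N - j) * \<phi> j)"
    by (subst sum.atMost_Suc_shift[of "\<lambda>j. real (N choose j) * p ^ j * (1 - p) ^ (Suc N - j) * \<phi> j"]) simp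
  also have "(\<Sum>j\<le>Suc N. real (N choose j) * p ^ j * (1 - p) ^ (Suc N - j) * \<phi> j) =
      (1 - p) * (\<Sum>j\<le>N. real (N choose j) * p ^ j * (1 - p) ^ (N - j) * \<phi> j)"
    by (simp add: sum_distrib_left Suc_diff_le binomial_eq_0 mult_ac)
  finally show ?thesis .
qed

section \<open>Law and moments of the counts in a sample\<close>

context finite_prob
begin

lemma iid_exp_count_list:
  "iid_exp q N (\<lambda>D. \<phi> (count_list D x)) =
    (\<Sum>j\<le>N. real (N choose j) * q x ^ j * (1 - q x) ^ (N - j) * \<phi> j)"
proof (induction N arbitrary: \<phi>)
  case (Suc N)
  have "(\<Sum>y\<in>UNIV - {x}. q y) = 1 - q x"
    by (simp add: sum_diff1 total)
  then have rest: "(\<Sum>y\<in>UNIV - {x}. q y * c) = (1 - q x) * c" for c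
    by (simp add: sum_distrib_right[symmetric])
  have "iid_exp q (Suc N) (\<lambda>D. \<phi> (count_list D x)) =
      q x * iid_exp q N (\<lambda>D. \<phi> (Suc (count_list D x))) +
      (\<Sum>y\<in>UNIV - {x}. q y * iid_exp q N (\<lambda>D. \<phi> (count_list D x)))"
    by (simp add: sum.remove[of UNIV x])
  also have "\<dots> = (\<Sum>j\<le>Suc N. real (Suc N choose j) * q x ^ j * (1 - q x) ^ (Suc N - j) * \<phi> j)"
    unfolding rest binomial_sum_Suc using Suc.IH[of "\<lambda>j. \<phi> (Suc j)"] Suc.IH[of \<phi>] by simp
  finally show ?case .
qed simp

lemma count_list_centered:
  "real (count_list D x) - real (length D) * q x = (\<Sum>y\<leftarrow>D. (if y = x then 1 else 0) - q x)"
  by (induction D) (auto simp: algebra_simps)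

lemma centered_indicator_mean: "(\<Sum>y\<in>UNIV. q y * ((if y \<in> A then 1 else 0) - (\<Sum>x\<in>A. q x))) = 0"
  by (simp add: right_diff_distrib sum_subtractf sum_distrib_right[symmetric] total
      if_distrib[of "\<lambda>x. _ * x"] sum.If_cases cong: if_cong)

lemma centered_indicator_variance:
  "(\<Sum>y\<in>UNIV. q y * ((if y \<in> A then 1 else 0) - (\<Sum>x\<in>A. q x))\<^sup>2) = (\<Sum>x\<in>A. q x) * (1 - (\<Sum>x\<in>A. q x))"
proof -
  let ?p = "\<Sum>x\<in>A. q x"
  have "q y * ((if y \<in> A then 1 else 0) - ?p)\<^sup>2 =
      (1 - 2 * ?p) * (q y * (if y \<in> A then 1 else 0)) + ?p\<^sup>2 * q y" for y
    by (auto simp: power2_eq_square algebra_simps)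
  then have "(\<Sum>y\<in>UNIV. q y * ((if y \<in> A then 1 else 0) - ?p)\<^sup>2) =
      (1 - 2 * ?p) * (\<Sum>y\<in>UNIV. q y * (if y \<in> A then 1 else 0)) + ?p\<^sup>2 * (\<Sum>y\<in>UNIV. q y)"
    by (simp add: sum.distrib sum_distrib_left)
  also have "(\<Sum>y\<in>UNIV. q y * (if y \<in> A then 1 else 0)) = ?p"
    by (simp add: if_distrib[of "\<lambda>x. _ * x"] sum.If_cases cong: if_cong)
  finally show ?thesis by (simp add: total power2_eq_square algebra_simps)
qed

lemma iid_exp_count_list_centered:
  "iid_exp q N (\<lambda>D. real (count_list D x) - real N * q x) = 0"
proof -
  have "iid_exp q N (\<lambda>D. real (count_list D x) - real N * q x) =
      iid_exp q N (\<lambda>D. \<Sum>y\<leftarrow>D. (if y = x then 1 else 0) - q x)"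
    by (rule iid_exp_cong) (simp add: count_list_centered[symmetric])
  also have "\<dots> = 0"
    using centered_indicator_mean[of "{x}"] by (intro iid_exp_sum_list) simp
  finally show ?thesis .
qed

lemma iid_exp_count_list_square:
  "iid_exp q N (\<lambda>D. (real (count_list D x) - real N * q x)\<^sup>2) = real N * (q x * (1 - q x))"
proof -
  have "iid_exp q N (\<lambda>D. (real (count_list D x) - real N * q x)\<^sup>2) =
      iid_exp q N (\<lambda>D. (\<Sum>y\<leftarrow>D. (if y = x then 1 else 0) - q x)\<^sup>2)"
    by (rule iid_exp_cong) (simp add: count_list_centered[symmetric])
  also have "\<dots> = real N * (q x * (1 - q x))"
    using centered_indicator_mean[of "{x}"] centered_indicator_variance[of "{x}"]
    by (subst iid_exp_sum_list_square) simp_all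
  finally show ?thesis .
qed

text \<open>Counts of different elements are dependent, but their total over \<open>A\<close> is
  again a sum of independent indicators.\<close>

lemma iid_exp_sum_count_list_square:
  "iid_exp q N (\<lambda>D. (\<Sum>x\<in>A. real (count_list D x) - real N * q x)\<^sup>2) =
    real N * ((\<Sum>x\<in>A. q x) * (1 - (\<Sum>x\<in>A. q x)))"
proof -
  have eq: "(\<Sum>x\<in>A. real (count_list D x) - real (length D) * q x) =
      (\<Sum>y\<leftarrow>D. (if y \<in> A then 1 else 0) - (\<Sum>x\<in>A. q x))" for D
  proof (induction D)
    case (Cons y D)
    have "(\<Sum>x\<in>A. real (count_list (y # D) x) - real (length (y # D)) * q x) =
        (\<Sum>x\<in>A. (if y = x then 1 else 0) - q x) + (\<Sum>x\<in>A. real (count_list D x) - real (length D) * q x)"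
      by (auto simp: sum.distrib[symmetric] algebra_simps intro!: sum.cong)
    with Cons show ?case by (simp add: sum_subtractf)
  qed simp
  have "iid_exp q N (\<lambda>D. (\<Sum>x\<in>A. real (count_list D x) - real N * q x)\<^sup>2) =
      iid_exp q N (\<lambda>D. (\<Sum>y\<leftarrow>D. (if y \<in> A then 1 else 0) - (\<Sum>x\<in>A. q x))\<^sup>2)"
    by (rule iid_exp_cong) (simp add: eq[symmetric])
  also have "\<dots> = real N * ((\<Sum>x\<in>A. q x) * (1 - (\<Sum>x\<in>A. q x)))"
    by (simp only: iid_exp_sum_list_square[OF centered_indicator_mean] centered_indicator_variance)
  finally show ?thesis .
qed

text \<open>A centred variable has positive and negative parts of equal mean.\<close>

lemma iid_exp_positive_part_count_list:
  "iid_exp q N (\<lambda>D. max 0 (real (count_list D x) - real N * q x)) = binomial_dev N (q x)"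
proof -
  have "(\<lambda>D. max 0 (real (count_list D x) - real N * q x)) =
      (\<lambda>D. (real (count_list D x) - real N * q x) + max 0 (real N * q x - real (count_list D x)))"
    by (auto simp: max_def)
  then have "iid_exp q N (\<lambda>D. max 0 (real (count_list D x) - real N * q x)) =
      iid_exp q N (\<lambda>D. max 0 (real N * q x - real (count_list D x)))"
    by (simp only: iid_exp_add iid_exp_count_list_centered add_0)
  also have "\<dots> = binomial_dev N (q x)"
    using iid_exp_count_list[of N "\<lambda>j. max 0 (real N * q x - real j)" x]
    by (simp add: binomial_dev_def)
  finally show ?thesis .
qed

lemma iid_exp_disjoint:
  "iid_exp q N (\<lambda>D. if set D \<inter> A = {} then 1 else 0) = (1 - (\<Sum>x\<in>A. q x)) ^ N"
proof (induction N)
  case (Suc N)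
  have "iid_exp q N (\<lambda>D. if set (x # D) \<inter> A = {} then 1 else 0) =
      (if x \<in> A then 0 else iid_exp q N (\<lambda>D. if set D \<inter> A = {} then 1 else 0))" for x
    by (simp add: iid_exp_const)
  then have "iid_exp q (Suc N) (\<lambda>D. if set D \<inter> A = {} then 1 else 0) =
      (\<Sum>x\<in>UNIV. if x \<in> A then 0 else q x * (1 - (\<Sum>x\<in>A. q x)) ^ N)"
    unfolding iid_exp.simps Suc.IH by (intro sum.cong) auto
  also have "\<dots> = (\<Sum>x\<in>- A. q x) * (1 - (\<Sum>x\<in>A. q x)) ^ N"
    by (simp add: sum.If_cases sum_distrib_right Compl_eq)
  also have "(\<Sum>x\<in>- A. q x) = 1 - (\<Sum>x\<in>A. q x)"
    by (simp add: Compl_eq_Diff_UNIV sum_diff total)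
  finally show ?case by simp
qed simp

end

lemma sum_singleton_Times: "(\<Sum>x\<in>{s} \<times> B. f x) = (\<Sum>b\<in>B. f (s, b))"
proof -
  have "{s} \<times> B = Pair s ` B" by auto
  then show ?thesis by (simp add: sum.reindex inj_on_def)
qed

section \<open>Bounds on the expected excess, first per state and then in total\<close>

locale finite_pair_prob = finite_prob q
  for q :: "'s::finite \<times> 'a::finite \<Rightarrow> real"
begin

definition marginal :: "'s \<Rightarrow> real" where
  "marginal s = (\<Sum>a\<in>UNIV. q (s, a))"

lemma marginal_eq: "marginal s = (\<Sum>x\<in>{s} \<times> UNIV. q x)"
  by (simp add: marginal_def sum_singleton_Times)

lemma marginal_nonneg: "0 \<le> marginal s"
  by (simp add: marginal_def sum_nonneg nonneg)

lemma sum_marginal: "(\<Sum>s\<in>UNIV. marginal s) = 1"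
  using total by (simp add: marginal_def sum.cartesian_product)

lemma marginal_le_1: "marginal s \<le> 1"
  using member_le_sum[of s UNIV marginal] by (simp add: marginal_nonneg sum_marginal)

text \<open>The maximum is at most the sum of two positive parts, whose means are binomial
  deviations. An unseen state, of probability \<open>(1 - marginal s) ^ N\<close>, contributes
  \<open>- c\<close>.\<close>

lemma expected_excess_le_two_actions:
  assumes "CARD('a) = 2" "N \<ge> 2"
  shows "iid_exp q N (\<lambda>D. excess (\<lambda>x. real N * q x) D s) \<le> sqrt (real N * marginal s * (ln 2 / 2))"
proof -
  obtain a b :: 'a where ab: "a \<noteq> b" "UNIV = {a, b}"
    using assms(1) by (auto simp: card_2_iff)
  define c where "c = min 1 (min (real N * q (s, a)) (real N * q (s, b)))"
  have marg: "marginal s = q (s, a) + q (s, b)"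
    unfolding marginal_def ab(2) using ab(1) by simp
  have rng: "range f = {f a, f b}" for f :: "'a \<Rightarrow> real"
    unfolding ab(2) by simp
  have pointwise: "excess (\<lambda>x. real N * q x) D s
    \<le> max 0 (real (count_list D (s, a)) - real N * q (s, a))
      + max 0 (real (count_list D (s, b)) - real N * q (s, b))
      - c * (if set D \<inter> ({s} \<times> UNIV) = {} then 1 else 0)" for D
  proof (cases "s \<in> data_states D")
    case True
    then have "set D \<inter> ({s} \<times> UNIV) \<noteq> {}" by (auto simp: data_states_def)
    with True show ?thesis by (simp add: excess_def rng)
  next
    case False
    then have "set D \<inter> ({s} \<times> UNIV) = {}" by (force simp: data_states_def)
    with False show ?thesis by (simp add: excess_def c_def rng)
  qed
  have "iid_exp q N (\<lambda>D. excess (\<lambda>x. real N * q x) D s)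
    \<le> iid_exp q N (\<lambda>D. max 0 (real (count_list D (s, a)) - real N * q (s, a))
      + max 0 (real (count_list D (s, b)) - real N * q (s, b))
      - c * (if set D \<inter> ({s} \<times> UNIV) = {} then 1 else 0))"
    by (intro iid_exp_mono pointwise)
  also have "\<dots> = binomial_dev N (q (s, a)) + binomial_dev N (q (s, b)) - c * (1 - marginal s) ^ N"
    unfolding iid_exp_diff iid_exp_add iid_exp_cmult iid_exp_positive_part_count_list
      iid_exp_disjoint marginal_eq ..
  also have "\<dots> \<le> 0.5886 * sqrt (real N * marginal s)"
    unfolding c_def marg using marginal_le_1[of s] assms(2)
    by (intro binomial_dev_pair_le) (auto simp: nonneg marg)
  also have "\<dots> = sqrt (0.5886\<^sup>2 * (real N * marginal s))"
    by (simp add: real_sqrt_mult)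
  also have "\<dots> \<le> sqrt ((ln 2 / 2) * (real N * marginal s))"
    using ln_2_ge marginal_nonneg[of s]
    by (intro real_sqrt_le_mono mult_right_mono) (auto simp: power2_eq_square)
  finally show ?thesis by (simp add: mult_ac)
qed

text \<open>
  Subtracting the multiple \<open>t\<close> of the centred total count does not change the expectation, but it
  lowers the second moment.
\<close>

lemma expected_excess_le_quadratic:
  fixes t \<beta> \<eta> :: real
  defines "k \<equiv> real CARD('a)"
  assumes k: "k > 1" and \<beta>: "0 \<le> \<beta>" and zero: "t\<^sup>2 \<le> \<beta> / k + \<eta>"
    and active: "\<And>X T. (X - t * (X + T))\<^sup>2 \<le> \<beta> * X\<^sup>2 + \<beta> * T\<^sup>2 / (k - 1) + \<eta> * (X + T)\<^sup>2"
  shows "iid_exp q N (\<lambda>D. excess (\<lambda>x. real N * q x) D s) \<le> sqrt (real N * marginal s * (\<beta> + \<eta>))"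
proof -
  define x where "x D a = real (count_list D (s, a)) - real N * q (s, a)" for D a
  define S where "S D = (\<Sum>a\<in>UNIV. x D a)" for D
  define Y where "Y D = Max (range (\<lambda>a. max 0 (x D a)))" for D
  have le_Y: "excess (\<lambda>x. real N * q x) D s \<le> Y D" for D
  proof (cases "s \<in> data_states D")
    case True
    then show ?thesis by (simp add: excess_def Y_def x_def)
  next
    case False
    have "0 \<le> Y D" unfolding Y_def by (rule Max_range_geI) simp
    moreover have "0 \<le> min 1 (Min (range (\<lambda>a. real N * q (s, a))))"
      by (simp add: nonneg)
    moreover have "excess (\<lambda>x. real N * q x) D s = - min 1 (Min (range (\<lambda>a. real N * q (s, a))))"
      using False by (simp add: excess_def)
    ultimately show ?thesis by argo
  qed
  have quad: "(Y D - t * S D)\<^sup>2 \<le> \<beta> * (\<Sum>a\<in>UNIV. (x D a)\<^sup>2) + \<eta> * (S D)\<^sup>2" for D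
  proof -
    have "Y D \<in> range (\<lambda>a. max 0 (x D a))" unfolding Y_def by (rule Max_in) auto
    then obtain a where "Y D = max 0 (x D a)" by auto
    \<comment> \<open>\<open>zero\<close> handles \<open>Y D = 0\<close> and \<open>active\<close>
      the case where the maximum is attained at \<open>a\<close>; Cauchy-Schwarz over the actions
      reduces each to these inequalities.\<close>
    then consider "Y D = 0" | "Y D = x D a" by linarith
    then show ?thesis
    proof cases
      case 1
      have "(S D)\<^sup>2 \<le> k * (\<Sum>a\<in>UNIV. (x D a)\<^sup>2)"
        unfolding S_def k_def using sum_squared_le_sum_of_squares[of "x D" UNIV] by (simp add: mult.commute)
      then have "\<beta> / k * (S D)\<^sup>2 \<le> \<beta> * (\<Sum>a\<in>UNIV. (x D a)\<^sup>2)"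
        using \<beta> k by (simp add: field_simps mult_left_mono)
      moreover have "t\<^sup>2 * (S D)\<^sup>2 \<le> (\<beta> / k + \<eta>) * (S D)\<^sup>2"
        by (intro mult_right_mono zero) simp
      ultimately show ?thesis using 1 by (simp add: power_mult_distrib algebra_simps)
    next
      case 2
      define T where "T = (\<Sum>b\<in>UNIV - {a}. x D b)"
      have S: "S D = x D a + T" unfolding S_def T_def by (simp add: sum.remove[of UNIV a])
      have "T\<^sup>2 \<le> (k - 1) * (\<Sum>b\<in>UNIV - {a}. (x D b)\<^sup>2)"
        unfolding T_def k_def using sum_squared_le_sum_of_squares[of "x D" "UNIV - {a}"]
        by (simp add: mult.commute of_nat_diff)
      then have "T\<^sup>2 / (k - 1) \<le> (\<Sum>b\<in>UNIV - {a}. (x D b)\<^sup>2)"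
        using k by (simp add: pos_divide_le_eq mult.commute)
      then have "\<beta> * T\<^sup>2 / (k - 1) \<le> \<beta> * (\<Sum>b\<in>UNIV - {a}. (x D b)\<^sup>2)"
        using mult_left_mono[OF _ \<beta>] by fastforce
      moreover have "(\<Sum>a\<in>UNIV. (x D a)\<^sup>2) = (x D a)\<^sup>2 + (\<Sum>b\<in>UNIV - {a}. (x D b)\<^sup>2)"
        by (simp add: sum.remove[of UNIV a])
      ultimately show ?thesis
        using active[of "x D a" T] unfolding 2 S by (simp add: algebra_simps)
    qed
  qed
  have ES: "iid_exp q N S = 0"
    unfolding S_def x_def iid_exp_sum iid_exp_count_list_centered by simp
  have "iid_exp q N (\<lambda>D. excess (\<lambda>x. real N * q x) D s) \<le> iid_exp q N (\<lambda>D. Y D)"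
    by (intro iid_exp_mono le_Y)
  also have "\<dots> = iid_exp q N (\<lambda>D. Y D - t * S D)"
    by (simp only: iid_exp_diff iid_exp_cmult ES mult_zero_right diff_zero)
  also have "\<dots> \<le> sqrt (iid_exp q N (\<lambda>D. (Y D - t * S D)\<^sup>2))"
    by (intro real_le_rsqrt iid_exp_square_ge)
  also have "\<dots> \<le> sqrt (real N * marginal s * (\<beta> + \<eta>))"
  proof (rule real_sqrt_le_mono)
    have "iid_exp q N (\<lambda>D. (Y D - t * S D)\<^sup>2) \<le>
        iid_exp q N (\<lambda>D. \<beta> * (\<Sum>a\<in>UNIV. (x D a)\<^sup>2) + \<eta> * (S D)\<^sup>2)"
      by (intro iid_exp_mono quad)
    also have "\<dots> = \<beta> * (\<Sum>a\<in>UNIV. real N * (q (s, a) * (1 - q (s, a)))) +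
        \<eta> * (real N * (marginal s * (1 - marginal s)))"
    proof -
      have "S D = (\<Sum>y\<in>{s} \<times> UNIV. real (count_list D y) - real N * q y)" for D
        by (simp add: S_def x_def sum_singleton_Times)
      then have "iid_exp q N (\<lambda>D. (S D)\<^sup>2) = real N * (marginal s * (1 - marginal s))"
        by (simp only: iid_exp_sum_count_list_square marginal_eq)
      then show ?thesis
        by (simp only: iid_exp_add iid_exp_cmult iid_exp_sum x_def iid_exp_count_list_square)
    qed
    also have "\<dots> = real N * (marginal s * (\<beta> + \<eta>) - (\<beta> * (\<Sum>a\<in>UNIV. (q (s, a))\<^sup>2) + \<eta> * (marginal s)\<^sup>2))"
      by (simp add: marginal_def sum_distrib_left[symmetric] right_diff_distrib sum_subtractf
          power2_eq_square algebra_simps)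
    \<comment> \<open>\<open>\<eta>\<close> may be negative, as it is in both applications;
      Cauchy-Schwarz and \<open>zero\<close> still make the subtracted quantity nonnegative.\<close>
    also have "\<dots> \<le> real N * (marginal s * (\<beta> + \<eta>))"
    proof -
      have "(marginal s)\<^sup>2 \<le> k * (\<Sum>a\<in>UNIV. (q (s, a))\<^sup>2)"
        unfolding marginal_def k_def using sum_squared_le_sum_of_squares[of "\<lambda>a. q (s, a)" UNIV]
        by (simp add: mult.commute)
      then have "\<beta> / k * (marginal s)\<^sup>2 \<le> \<beta> * (\<Sum>a\<in>UNIV. (q (s, a))\<^sup>2)"
        using \<beta> k by (simp add: field_simps mult_left_mono)
      moreover have "0 \<le> (\<beta> / k + \<eta>) * (marginal s)\<^sup>2"
        using zero by (intro mult_nonneg_nonneg) (auto intro: order.trans[OF zero_le_power2])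
      ultimately have "0 \<le> \<beta> * (\<Sum>a\<in>UNIV. (q (s, a))\<^sup>2) + \<eta> * (marginal s)\<^sup>2"
        by (simp add: algebra_simps)
      then show ?thesis by (intro mult_left_mono) auto
    qed
    finally show "iid_exp q N (\<lambda>D. (Y D - t * S D)\<^sup>2) \<le> real N * marginal s * (\<beta> + \<eta>)"
      by (simp add: mult.assoc)
  qed
  finally show ?thesis .
qed

lemma expected_excess_le:
  assumes "CARD('a) \<ge> 2" "N \<ge> 2"
  shows "iid_exp q N (\<lambda>D. excess (\<lambda>x. real N * q x) D s)
    \<le> sqrt (real N * marginal s * (ln (real CARD('a)) / 2))"
proof -
  have mono: "sqrt (real N * marginal s * c) \<le> sqrt (real N * marginal s * d)" if "c \<le> d" for c d
    using that marginal_nonneg[of s] by (intro real_sqrt_le_mono mult_left_mono) auto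
  consider "CARD('a) = 2" | "CARD('a) = 3" | "CARD('a) \<ge> 4" using assms(1) by linarith
  then show ?thesis
  proof cases
    case 1
    with expected_excess_le_two_actions[OF 1 assms(2)] show ?thesis by simp
  next
    case 2
    have "iid_exp q N (\<lambda>D. excess (\<lambda>x. real N * q x) D s)
      \<le> sqrt (real N * marginal s * (0.692 + - 0.149))"
      \<comment> \<open>A numerical near-optimum; the choice made below for four or more actions just fails here.\<close>
    proof (rule expected_excess_le_quadratic[where t = "0.28"])
      show "(X - 0.28 * (X + T))\<^sup>2 \<le> 0.692 * X\<^sup>2 + 0.692 * T\<^sup>2 / (real CARD('a) - 1) + - 0.149 * (X + T)\<^sup>2"
        for X T :: real
      proof -
        \<comment> \<open>The factor 0.0246 is the coefficient of \<open>X\<^sup>2\<close> in the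
          difference, so multiplying by it completes the square.\<close>
        have "0.0246 * (0.692 * X\<^sup>2 + 0.692 * T\<^sup>2 / (real CARD('a) - 1) + - 0.149 * (X + T)\<^sup>2
            - (X - 0.28 * (X + T))\<^sup>2) = (0.0246 * X + 0.0526 * T)\<^sup>2 + 0.0001508 * T\<^sup>2"
          unfolding 2 by (simp add: power2_eq_square field_simps)
        also have "\<dots> \<ge> 0" by simp
        finally show ?thesis by (simp add: zero_le_mult_iff)
      qed
    qed (simp_all add: 2 power2_eq_square)
    also have "\<dots> \<le> sqrt (real N * marginal s * (ln (real CARD('a)) / 2))"
      using ln_3_ge by (intro mono) (simp add: 2)
    finally show ?thesis .
  next
    case 3
    define k where "k = real CARD('a)"
    have k: "k \<ge> 4" using 3 by (simp add: k_def)
    have "iid_exp q N (\<lambda>D. excess (\<lambda>x. real N * q x) D s)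
      \<le> sqrt (real N * marginal s * (k / (k + 1) + - k / (k + 1)\<^sup>2))"
    \<comment> \<open>These parameters turn \<open>zero\<close> into an equality, and in
      \<open>active\<close> the two sides differ only by a multiple of
      \<open>T\<^sup>2\<close>.\<close>
    proof (rule expected_excess_le_quadratic[where t = "1 / (k + 1)"], fold k_def)
      show "(1 / (k + 1))\<^sup>2 \<le> k / (k + 1) / k + - k / (k + 1)\<^sup>2"
      proof -
        have "k / (k + 1) / k = (k + 1) / (k + 1)\<^sup>2"
          using k by (simp add: power2_eq_square)
        then show ?thesis by (simp add: power_divide add_divide_distrib)
      qed
      show "(X - 1 / (k + 1) * (X + T))\<^sup>2 \<le>
          k / (k + 1) * X\<^sup>2 + k / (k + 1) * T\<^sup>2 / (k - 1) + - k / (k + 1)\<^sup>2 * (X + T)\<^sup>2" for X T :: real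
      proof -
        have "1 * T\<^sup>2 \<le> 2 * k / (k - 1) * T\<^sup>2"
          using k by (intro mult_right_mono) (auto simp: field_simps)
        then have "T\<^sup>2 \<le> 2 * k / (k - 1) * T\<^sup>2" by simp
        have "X - 1 / (k + 1) * (X + T) = (k * X - T) / (k + 1)"
          using k by (simp add: field_simps)
        then have "(X - 1 / (k + 1) * (X + T))\<^sup>2 = (k * X - T)\<^sup>2 / (k + 1)\<^sup>2"
          by (simp add: power_divide)
        also have "\<dots> \<le> ((k * X - T)\<^sup>2 + (2 * k / (k - 1) * T\<^sup>2 - T\<^sup>2)) / (k + 1)\<^sup>2"
          using \<open>T\<^sup>2 \<le> 2 * k / (k - 1) * T\<^sup>2\<close> by (intro divide_right_mono) auto
        also have "\<dots> = k / (k + 1) * X\<^sup>2 + k / (k + 1) * T\<^sup>2 / (k - 1) + - k / (k + 1)\<^sup>2 * (X + T)\<^sup>2"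
        proof -
          have "k - 1 \<noteq> 0" "k + 1 \<noteq> 0" using k by auto
          then show ?thesis
            by (simp add: divide_simps) (simp add: power2_eq_square algebra_simps)
        qed
        finally show ?thesis .
      qed
    qed (use k in auto)
    also have "k / (k + 1) + - k / (k + 1)\<^sup>2 = (real CARD('a) / real (CARD('a) + 1))\<^sup>2"
    proof -
      have "k / (k + 1) = k * (k + 1) / (k + 1)\<^sup>2"
        using k by (simp add: power2_eq_square)
      then have "k / (k + 1) + - k / (k + 1)\<^sup>2 = (k * (k + 1) + - k) / (k + 1)\<^sup>2"
        by (simp only: add_divide_distrib)
      also have "\<dots> = (k / (k + 1))\<^sup>2"
        by (simp add: power_divide power2_eq_square algebra_simps)
      finally show ?thesis by (simp add: k_def add.commute)
    qed
    also have "sqrt (real N * marginal s * (real CARD('a) / real (CARD('a) + 1))\<^sup>2) \<le>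
        sqrt (real N * marginal s * (ln (real CARD('a)) / 2))"
      by (intro mono square_ratio_le_half_ln 3)
    finally show ?thesis .
  qed
qed

text \<open>Cauchy-Schwarz over the states, whose marginals sum to 1. The product of
  \<open>CARD('s)\<close> and \<open>ln CARD('a)\<close> is the logarithm of the number of
  deterministic policies.\<close>

lemma expected_sum_excess_le:
  assumes "CARD('a) \<ge> 2" "N \<ge> 2"
  shows "iid_exp q N (\<lambda>D. \<Sum>s\<in>UNIV. excess (\<lambda>x. real N * q x) D s)
    \<le> sqrt (real N * (real CARD('s) * ln (real CARD('a))) / 2)"
proof -
  have "iid_exp q N (\<lambda>D. \<Sum>s\<in>UNIV. excess (\<lambda>x. real N * q x) D s)
      \<le> (\<Sum>s\<in>UNIV. sqrt (real N * marginal s * (ln (real CARD('a)) / 2)))"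
    unfolding iid_exp_sum by (intro sum_mono expected_excess_le assms)
  also have "\<dots> \<le> sqrt (real N * (real CARD('s) * ln (real CARD('a))) / 2)"
  proof (rule real_le_rsqrt)
    have "(\<Sum>s\<in>UNIV. sqrt (real N * marginal s * (ln (real CARD('a)) / 2)))\<^sup>2
        \<le> real CARD('s) * (\<Sum>s\<in>UNIV. (sqrt (real N * marginal s * (ln (real CARD('a)) / 2)))\<^sup>2)"
      using sum_squared_le_sum_of_squares[of
          "\<lambda>s. sqrt (real N * marginal s * (ln (real CARD('a)) / 2))" "UNIV :: 's set"]
      by (simp add: mult.commute)
    also have "(\<Sum>s\<in>UNIV. (sqrt (real N * marginal s * (ln (real CARD('a)) / 2)))\<^sup>2) =
        (\<Sum>s\<in>UNIV. real N * marginal s * (ln (real CARD('a)) / 2))"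
      using assms by (intro sum.cong) (auto simp: marginal_nonneg)
    also have "\<dots> = real N * (ln (real CARD('a)) / 2)"
      using sum_marginal by (simp add: sum_distrib_left[symmetric] sum_distrib_right[symmetric] sum_divide_distrib[symmetric])
    finally show "(\<Sum>s\<in>UNIV. sqrt (real N * marginal s * (ln (real CARD('a)) / 2)))\<^sup>2
        \<le> real N * (real CARD('s) * ln (real CARD('a))) / 2"
      by (simp add: mult_ac)
  qed
  finally show ?thesis .
qed

end

section \<open>Occupancy measures\<close>

lemma state_dist_nonneg: "0 \<le> state_dist mu0 P pol t s"
  by (induction t arbitrary: s) (auto intro!: sum_nonneg)

lemma sum_pmf_UNIV: "(\<Sum>x\<in>UNIV. pmf p x) = 1" for p :: "'x::finite pmf"
  by (rule sum_pmf_eq_1) auto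

lemma sum_state_dist: "(\<Sum>s\<in>UNIV. state_dist mu0 P pol t s) = 1"
proof (induction t)
  case 0
  then show ?case by (simp add: sum_pmf_UNIV)
next
  case (Suc t)
  have "(\<Sum>s\<in>UNIV. state_dist mu0 P pol (Suc t) s) =
      (\<Sum>s'\<in>UNIV. \<Sum>a\<in>UNIV. \<Sum>s\<in>UNIV. state_dist mu0 P pol t s' * pmf (pol s') a * pmf (P s' a) s)"
    by (simp only: state_dist.simps, subst sum.swap, intro sum.cong refl, rule sum.swap)
  also have "\<dots> = (\<Sum>s'\<in>UNIV. state_dist mu0 P pol t s')"
    by (simp add: sum_distrib_left[symmetric] sum_pmf_UNIV)
  finally show ?case using Suc by simp
qed

lemma state_dist_le_1: "state_dist mu0 P pol t s \<le> 1"
  using member_le_sum[of s UNIV "state_dist mu0 P pol t"]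
  by (simp add: state_dist_nonneg sum_state_dist)

lemma summable_discounted_state_dist:
  assumes "0 \<le> \<gamma>" "\<gamma> < 1"
  shows "summable (\<lambda>t. \<gamma> ^ t * state_dist mu0 P pol t s)"
proof (rule summable_comparison_test)
  show "summable (\<lambda>t. \<gamma> ^ t)" using assms by (intro summable_geometric) simp
  show "\<exists>N. \<forall>t\<ge>N. norm (\<gamma> ^ t * state_dist mu0 P pol t s) \<le> \<gamma> ^ t"
    using assms by (auto simp: abs_mult state_dist_nonneg intro!: mult_left_le state_dist_le_1)
qed

lemma occ_state_nonneg:
  assumes "0 \<le> \<gamma>" "\<gamma> < 1"
  shows "0 \<le> occ_state \<gamma> mu0 P pol s"
  unfolding occ_state_def using assms
  by (intro mult_nonneg_nonneg suminf_nonneg summable_discounted_state_dist)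
     (auto simp: state_dist_nonneg)

text \<open>Each step distribution has mass 1, so the factor \<open>1 - \<gamma>\<close> cancels the
  geometric series.\<close>

lemma sum_occ_state:
  assumes "0 \<le> \<gamma>" "\<gamma> < 1"
  shows "(\<Sum>s\<in>UNIV. occ_state \<gamma> mu0 P pol s) = 1"
proof -
  have "(\<Sum>s\<in>UNIV. \<Sum>t. \<gamma> ^ t * state_dist mu0 P pol t s) =
      (\<Sum>t. \<Sum>s\<in>UNIV. \<gamma> ^ t * state_dist mu0 P pol t s)"
    using assms by (intro suminf_sum[symmetric] summable_discounted_state_dist)
  also have "\<dots> = (\<Sum>t. \<gamma> ^ t)"
    by (simp add: sum_distrib_left[symmetric] sum_state_dist)
  also have "\<dots> = 1 / (1 - \<gamma>)"
    using assms by (intro suminf_geometric) simp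
  finally show ?thesis
    using assms by (simp add: occ_state_def sum_distrib_left[symmetric])
qed

lemma sum_occ_sa: "(\<Sum>a\<in>UNIV. occ_sa \<gamma> mu0 P pol s a) = occ_state \<gamma> mu0 P pol s"
  by (simp add: occ_sa_def sum_distrib_right[symmetric] sum_pmf_UNIV)

lemma finite_pair_prob_occ_sa:
  assumes "0 \<le> \<gamma>" "\<gamma> < 1"
  shows "finite_pair_prob (\<lambda>(s, a). occ_sa \<gamma> mu0 P pol s a)"
proof unfold_locales
  show "0 \<le> (case x of (s, a) \<Rightarrow> occ_sa \<gamma> mu0 P pol s a)" for x
    using assms by (auto simp: occ_sa_def occ_state_nonneg split: prod.splits)
  have "(\<Sum>x\<in>UNIV. case x of (s, a) \<Rightarrow> occ_sa \<gamma> mu0 P pol s a) =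
      (\<Sum>s\<in>UNIV. \<Sum>a\<in>UNIV. occ_sa \<gamma> mu0 P pol s a)"
    by (simp add: sum.cartesian_product)
  then show "(\<Sum>x\<in>UNIV. case x of (s, a) \<Rightarrow> occ_sa \<gamma> mu0 P pol s a) = 1"
    by (simp add: sum_occ_sa sum_occ_state assms)
qed

lemma occ_sa_det_pol:
  "occ_sa \<gamma> mu0 P (det_pol f) s a = (if a = f s then occ_state \<gamma> mu0 P (det_pol f) s else 0)"
  by (simp add: occ_sa_def det_pol_def pmf_return)

text \<open>The quantifier over \<open>pol\<close> stands inside the event, so the cloned policy may
  depend on the data in any way. The assumption that no policy fits the data is a premise inside the
  event as well.\<close>

theorem theorem1:
  fixes mu0 :: "'s::finite pmf" and P :: "'s \<Rightarrow> 'a::finite \<Rightarrow> 's pmf"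
    and \<gamma> :: real and pib pi0 :: "'s \<Rightarrow> 'a pmf" and N :: nat and \<delta> :: real
  assumes "0 \<le> \<gamma>" and "\<gamma> < 1" and "N > 0" and "0 < \<delta>" and "\<delta> < 1"
  shows "data_prob N (\<lambda>(s, a). occ_sa \<gamma> mu0 P pib s a)
     (\<lambda>D. (\<not> (\<exists>f :: 's \<Rightarrow> 'a. \<forall>i<N. f (fst (D ! i)) = snd (D ! i))) \<longrightarrow>
        (\<forall>pol :: 's \<Rightarrow> 'a.
           tv (\<lambda>(s, a). occ_sa \<gamma> mu0 P (det_pol pol) s a) (\<lambda>(s, a). occ_sa \<gamma> mu0 P pib s a)
           \<le> (1/2) * (\<Sum>s\<in>- data_states D. occ_state \<gamma> mu0 P pib s)
             + (1/2) * (\<Sum>s\<in>- data_states D.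
                  \<bar>occ_state \<gamma> mu0 P (det_pol pol) s - occ_state \<gamma> mu0 P pi0 s\<bar>)
             + (1/2) * (\<Sum>s\<in>- data_states D.
                  \<bar>occ_state \<gamma> mu0 P pi0 s - occ_state \<gamma> mu0 P pib s\<bar>)
             + (1/2) * (\<Sum>s\<in>data_states D.
                  \<bar>occ_state \<gamma> mu0 P (det_pol pol) s - emp_state D s\<bar>)
             + (1 / real N) * (\<Sum>i<N. if pol (fst (D ! i)) \<noteq> snd (D ! i) then 1 else 0)
             + sqrt ((ln (real CARD('s)) + ln (2 / \<delta>)) / (2 * real N))
             + sqrt ((ln (real (CARD('a) ^ CARD('s))) + ln (2 / \<delta>)) / (2 * real N))))
     \<ge> 1 - \<delta>"
    (is "data_prob N ?q ?E \<ge> 1 - \<delta>")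
proof -
  interpret finite_pair_prob ?q
    by (rule finite_pair_prob_occ_sa) (use assms in auto)
  show ?thesis
  proof (cases "N \<ge> 2 \<and> CARD('a) \<ge> 2")
    case False
    have "\<exists>f :: 's \<Rightarrow> 'a. \<forall>i<N. f (fst (D ! i)) = snd (D ! i)" for D
    proof (cases "N = 1")
      case True
      then show ?thesis by (intro exI[of _ "\<lambda>_. snd (D ! 0)"]) simp
    next
      case N: False
      have "CARD('a) \<noteq> 0" by simp
      with False N assms have "CARD('a) = 1" by linarith
      then obtain a :: 'a where "UNIV = {a}" by (auto simp: card_1_singleton_iff)
      then have "x = y" for x y :: 'a by (metis UNIV_I singletonD)
      then show ?thesis by blast
    qed
    then have "data_prob N ?q ?E = 1"
      unfolding data_prob_eq_iid_exp by (simp add: iid_exp_const)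
    then show ?thesis using assms by simp
  next
    case True
    define Z where "Z D = (\<Sum>s\<in>UNIV. excess (\<lambda>x. real N * ?q x) D s)" for D
    \<comment> \<open>Chosen so that McDiarmid's failure probability
      \<open>exp (- 2 * t\<^sup>2 / N)\<close> equals \<open>\<delta>\<close>.\<close>
    define t where "t = sqrt (real N * ln (1 / \<delta>) / 2)"
    have t: "t > 0" using assms by (simp add: t_def)
    have "t\<^sup>2 = real N * ln (1 / \<delta>) / 2"
      using assms by (simp add: t_def)
    then have "1 - \<delta> = 1 - exp (- 2 * t\<^sup>2 / real N)"
      using assms by (simp add: ln_div)
    also have "\<dots> \<le> iid_exp ?q N (\<lambda>D. if Z D \<le> iid_exp ?q N Z + t then 1 else 0)"
      unfolding Z_def using assms(3) t
      by (rule McDiarmid_inequality) (intro sum_excess_bounded_difference mult_nonneg_nonneg nonneg, simp)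
    also have "\<dots> \<le> data_prob N ?q ?E"
      unfolding data_prob_eq_iid_exp
    proof (rule iid_exp_mono)
      fix D :: "('s \<times> 'a) list"
      assume D: "length D = N"
      let ?e1 = "sqrt ((ln (real CARD('s)) + ln (2 / \<delta>)) / (2 * real N))"
      let ?e2 = "sqrt ((ln (real (CARD('a) ^ CARD('s))) + ln (2 / \<delta>)) / (2 * real N))"
      have "?E D" if Z: "Z D \<le> iid_exp ?q N Z + t"
      proof (intro impI allI)
        fix pol :: "'s \<Rightarrow> 'a"
        have "iid_exp ?q N Z / real N \<le> sqrt (real N * (real CARD('s) * ln (real CARD('a))) / 2) / real N"
          unfolding Z_def using True by (intro divide_right_mono expected_sum_excess_le) auto
        also have "\<dots> = sqrt (real CARD('s) * ln (real CARD('a)) / (2 * real N))"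
          using assms(3) by (simp add: real_sqrt_divide real_sqrt_mult field_simps)
        \<comment> \<open>The mean is covered by the policy-counting term alone; adding
          \<open>ln (2 / \<delta>)\<close>, which is positive, only enlarges the root.\<close>
        also have "\<dots> \<le> ?e2"
          using assms
          by (intro real_sqrt_le_mono divide_right_mono) (auto simp: ln_realpow)
        finally have "iid_exp ?q N Z / real N \<le> ?e2" .
        moreover have "t / real N \<le> ?e1"
        proof -
          have "t / real N = sqrt (ln (1 / \<delta>) / (2 * real N))"
            unfolding t_def using assms(3) by (simp add: real_sqrt_divide real_sqrt_mult field_simps)
          also have "\<dots> \<le> ?e1"
          proof -
            have "ln (1 / \<delta>) \<le> ln (2 / \<delta>)" using assms by (simp add: divide_right_mono)
            moreover have "0 \<le> ln (real CARD('s))" by (simp add: Suc_leI)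
            ultimately have "ln (1 / \<delta>) \<le> ln (real CARD('s)) + ln (2 / \<delta>)" by linarith
            then show ?thesis
              by (intro real_sqrt_le_mono divide_right_mono) auto
          qed
          finally show ?thesis .
        qed
        moreover have "Z D / real N \<le> iid_exp ?q N Z / real N + t / real N"
          using divide_right_mono[OF Z, of "real N"] by (simp add: add_divide_distrib)
        ultimately have Z': "Z D / real N \<le> ?e1 + ?e2" by linarith
        have "finite_prob ?q" by unfold_locales
        note tv_le_excess[OF this D assms(3), of pol "occ_state \<gamma> mu0 P (det_pol pol)"
            "occ_state \<gamma> mu0 P pi0", folded Z_def]
        then show "tv (\<lambda>(s, a). occ_sa \<gamma> mu0 P (det_pol pol) s a) ?q
           \<le> (1/2) * (\<Sum>s\<in>- data_states D. occ_state \<gamma> mu0 P pib s)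
             + (1/2) * (\<Sum>s\<in>- data_states D.
                  \<bar>occ_state \<gamma> mu0 P (det_pol pol) s - occ_state \<gamma> mu0 P pi0 s\<bar>)
             + (1/2) * (\<Sum>s\<in>- data_states D.
                  \<bar>occ_state \<gamma> mu0 P pi0 s - occ_state \<gamma> mu0 P pib s\<bar>)
             + (1/2) * (\<Sum>s\<in>data_states D.
                  \<bar>occ_state \<gamma> mu0 P (det_pol pol) s - emp_state D s\<bar>)
             + (1 / real N) * (\<Sum>i<N. if pol (fst (D ! i)) \<noteq> snd (D ! i) then 1 else 0)
             + ?e1 + ?e2"
          using Z' unfolding occ_sa_det_pol prod.case sum_occ_sa by linarith
      qed
      then show "(if Z D \<le> iid_exp ?q N Z + t then 1 else 0) \<le> (if ?E D then 1 else (0::real))"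
        by (simp only: split: if_split) simp
    qed
    finally show ?thesis .
  qed
qed

end
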